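(* Let $d\tilde\rho(\xi)$ be an even probability measure on $\mathbb{R}$ whose essential support coincides with the interval $[-2,2]$, which has only a finite number of mass points on $\mathbb{R}\setminus[-2,2]$, and which satisfies the Szegő condition $$\int_{-2}^{2}\frac{\ln\tilde\rho\,'(\xi)}{\sqrt{4-\xi^2}}\,d\xi>-\infty .$$ Then $d\tilde\rho(\xi)$ generates a semi-infinite Volterra lattice with a finite logarithmic Hamiltonian by means of the following procedure. (a) For $t\in[0,T)$ define the measure $$d\tilde\rho(\xi,t)=\frac{e^{\xi^2t}\,d\tilde\rho(\xi)}{\int_{-\infty}^{\infty}e^{\xi^2t}\,d\tilde\rho(\xi)} .$$ (b) Calculate the moments $\tilde s_k(t)=\int_{-\infty}^{\infty}\xi^k\,d\tilde\rho(\xi,t)$, $k\in\mathbb{Z}_+$ (those with odd index vanish). (c) Set $$\tilde a_n(t)=\frac{\tilde\Delta_{n+1}(t)\,\tilde\Delta_{n-1}(t)}{\tilde\Delta_n(t)^2},\quad n\in\mathbb{Z}_+,\qquad \tilde\Delta_n(t)=\det(\tilde s_{i+j}(t))_{i,j=0}^{n},\quad \tilde\Delta_{-1}=1 .$$ That is, the functions $\tilde a_n(t)$ are positive and satisfy $$\frac{d}{dt}\tilde a_n=\tilde a_n(\tilde a_{n+1}-\tilde a_{n-1}),\quad n\in\mathbb{Z}_+,\qquad \tilde a_{-1}=0,$$ for $t\in[0,T)$, and for each $t\in[0,T)$ the logarithmic Hamiltonian $\tilde H_0=\sum_{n=0}^{\infty}\ln\tilde a_n(t)$ is finite.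
   Context: $\mathbb{Z}_+=\{0,1,2,\dots\}$; $0<T\le\infty$. A measure is even if it is invariant under $\xi\mapsto-\xi$. The essential support of a measure is its topological support with isolated points removed (equivalently, the essential spectrum of the Jacobi operator whose spectral measure it is). $\tilde\rho\,'$ denotes the density (derivative) of the absolutely continuous part of $\tilde\rho$. "The logarithmic Hamiltonian is finite" means that the series $\sum_n\ln\tilde a_n(t)$ converges to a finite number, i.e. $0<\prod_{n=0}^{\infty}\tilde a_n(t)<\infty$ with the infinite product convergent. *)

theory Defs
  imports
    "HOL-Probability.Probability"
    "HOL-Analysis.Isolated"
    "Jordan_Normal_Form.Determinant"
begin

definition even_measure :: "real measure \<Rightarrow> bool" where
  "even_measure M \<longleftrightarrow> distr M borel uminus = M"

definition topological_support :: "'a::topological_space measure \<Rightarrow> 'a set" where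
  "topological_support M = {x. \<forall>U. open U \<and> x \<in> U \<longrightarrow> emeasure M U > 0}"

definition essential_support :: "'a::topological_space measure \<Rightarrow> 'a set" where
  "essential_support M =
     {x \<in> topological_support M. \<not> x isolated_in topological_support M}"

(* w is a version of the density of the absolutely continuous part in the Lebesgue decomposition
   M = w dx + N with N singular; such a w exists for every finite Borel measure and is unique
   up to a Lebesgue null set. *)
definition ac_part_density :: "real measure \<Rightarrow> (real \<Rightarrow> real) \<Rightarrow> bool" where
  "ac_part_density M w \<longleftrightarrow>
     w \<in> borel_measurable borel \<and> (\<forall>x. 0 \<le> w x) \<and>
     (\<exists>N. sets N = sets borel \<and>
          (\<exists>A \<in> null_sets lborel. emeasure N (- A) = 0) \<and>
          (\<forall>B \<in> sets borel.
             emeasure M B = emeasure (density lborel (\<lambda>x. ennreal (w x))) B + emeasure N B))"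

(* The library has ln 0 = 0 on the reals; the Szego condition needs ln 0 = -\<infinity>. *)
definition ereal_ln :: "real \<Rightarrow> ereal" where
  "ereal_ln x = (if 0 < x then ereal (ln x) else - \<infinity>)"

(* Integral of the positive part minus integral of the negative part. Only meaningful if one of
   the two is finite, because \<infinity> - \<infinity> = \<infinity> in ereal. *)
definition ereal_integral :: "'a measure \<Rightarrow> ('a \<Rightarrow> ereal) \<Rightarrow> ereal" where
  "ereal_integral M f =
     enn2ereal (\<integral>\<^sup>+ x. e2ennreal (f x) \<partial>M) - enn2ereal (\<integral>\<^sup>+ x. e2ennreal (- f x) \<partial>M)"

(* If w is the density of a finite measure then the positive part of the integrand is integrable
   (substitute \<xi> = 2 cos \<theta> and use ln y \<le> y), so the case \<infinity> - \<infinity> does not occur. *)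
definition szego_condition :: "(real \<Rightarrow> real) \<Rightarrow> bool" where
  "szego_condition w \<longleftrightarrow>
     ereal_integral (restrict_space lborel {-2..2})
       (\<lambda>\<xi>. ereal_ln (w \<xi>) / ereal (sqrt (4 - \<xi>\<^sup>2))) > - \<infinity>"

definition evolved_measure :: "real measure \<Rightarrow> real \<Rightarrow> real measure" where
  "evolved_measure M t =
     density M (\<lambda>\<xi>. ennreal (exp (\<xi>\<^sup>2 * t) / (\<integral>\<eta>. exp (\<eta>\<^sup>2 * t) \<partial>M)))"

definition moment :: "real measure \<Rightarrow> nat \<Rightarrow> real" where
  "moment M k = (\<integral>\<xi>. \<xi> ^ k \<partial>M)"

(* Indexed by the size of the matrix: hankel_det s (n + 1) is the determinant of
   (s_(i+j)) for i, j = 0, ..., n, usually written Delta_n, and Delta_(-1) is hankel_det s 0 = 1. *)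
definition hankel_det :: "(nat \<Rightarrow> real) \<Rightarrow> nat \<Rightarrow> real" where
  "hankel_det s m = Determinant.det (mat m m (\<lambda>(i, j). s (i + j)))"

lemma hankel_det_0: "hankel_det s 0 = 1"
  by (simp add: hankel_det_def)

definition volterra_coeff :: "real measure \<Rightarrow> nat \<Rightarrow> real \<Rightarrow> real" where
  "volterra_coeff M n t =
     (let s = moment (evolved_measure M t)
      in hankel_det s (n + 2) * hankel_det s n / (hankel_det s (n + 1))\<^sup>2)"

end

theory Submission
  imports
    Defs
    "HOL-Complex_Analysis.Complex_Analysis"
    "HOL-Computational_Algebra.Fundamental_Theorem_Algebra"
    "HOL-Real_Asymp.Real_Asymp"
begin

text \<open>
  Since \<open>a\<close> is invariant under scaling the moments, one may work with \<open>e\<^bsup>x\<^sup>2 t\<^esup> d\<rho>\<close>. With \<open>h\<^sub>n\<close> the squared norm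
  of its \<open>n\<close>-th monic orthogonal polynomial, \<open>a\<^sub>n = h\<^sub>n\<^sub>+\<^sub>1 / h\<^sub>n\<close>. Differentiating \<open>h\<^sub>n\<close>, the derivative of
  the polynomial has lower degree and drops out by orthogonality, which leaves
  \<open>h\<^sub>n' = \<parallel>x P\<^sub>n\<parallel>\<^sup>2 = h\<^sub>n\<^sub>+\<^sub>1 + h\<^sub>n\<^sup>2 / h\<^sub>n\<^sub>-\<^sub>1\<close> and hence the Volterra equations.

  The logarithmic Hamiltonian telescopes, so it has to be shown that \<open>h\<^sub>n\<close>, the minimum of \<open>\<integral> P\<^sup>2\<close> over the
  monic \<open>P\<close> of degree \<open>n\<close>, has a positive limit. On the interval, this minimum is asymptotically twice the
  infimum of \<open>\<integral> |Q(\<zeta>)|\<^sup>2\<close> over all real polynomials with \<open>Q(0) = 1\<close>, where \<open>x = \<zeta> + 1/\<zeta>\<close> and \<open>|\<zeta>| = 1\<close>;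
  Jensen's inequality for \<open>ln |Q|\<close> and the Szego condition make the infimum positive. A mass point \<open>y\<close>
  outside the interval forces almost minimal polynomials to vanish nearly at \<open>y\<close>, so that it may be removed
  at the cost of multiplying the measure by \<open>(x - y)\<^sup>2\<close>.
\<close>

section \<open>Orthogonal polynomials and the Volterra lattice\<close>

text \<open>Convergence of the series asks for a limit of \<open>h n\<close>; bounds away from 0 and
  infinity would not do, since these norms need not be monotone. This is why the extremal problem is
  treated as a two-sided limit. The interval [-2,2] has logarithmic capacity 1, so for monic
  polynomials the norms neither grow nor decay geometrically, and lowering the degree by one, as the
  removal of a mass point does, leaves the limit unchanged. On the interval the limit comes from
  Hilbert space geometry applied to the full measure, singular part included. The Szego condition
  enters only through positivity of the infimum, where the measure may be replaced by a smaller one.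
  Hence the density \<open>w\<close> of the original measure can be kept throughout: both exp (x^2
  t) with t \<ge> 0 and the factors (x - y)^2 are bounded below by a positive constant on [-2,2].
  Finitely many mass points also make the support bounded, so that all exponential integrals
  converge and T may be infinite.\<close>

definition moment_functional :: "(nat \<Rightarrow> real) \<Rightarrow> real poly \<Rightarrow> real" where
  "moment_functional s p = (\<Sum>i\<le>degree p. coeff p i * s i)"

lemma moment_functional_altdef:
  "degree p \<le> N \<Longrightarrow> moment_functional s p = (\<Sum>i\<le>N. coeff p i * s i)"
  unfolding moment_functional_def
  by (rule sum.mono_neutral_left) (auto intro: coeff_eq_0)

lemma moment_functional_add [simp]:
  "moment_functional s (p + q) = moment_functional s p + moment_functional s q"
  by (simp add: moment_functional_altdef[of _ "max (degree p) (degree q)"] degree_add_le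
      sum.distrib algebra_simps)

lemma moment_functional_smult [simp]:
  "moment_functional s (Polynomial.smult c p) = c * moment_functional s p"
  by (cases "c = 0") (auto simp: moment_functional_def sum_distrib_left algebra_simps)

lemma moment_functional_numeral [simp]:
  "moment_functional s (numeral k * p) = numeral k * moment_functional s p"
  using moment_functional_smult[of s "numeral k" p] by (simp add: numeral_poly)

lemma moment_functional_minus [simp]:
  "moment_functional s (- p) = - moment_functional s p"
  using moment_functional_smult[of s "-1" p] by simp

lemma moment_functional_diff [simp]:
  "moment_functional s (p - q) = moment_functional s p - moment_functional s q"
  using moment_functional_add[of s p "- q"] by simp

lemma moment_functional_0 [simp]: "moment_functional s 0 = 0"
  by (simp add: moment_functional_def)

lemma moment_functional_sum:
  "moment_functional s (\<Sum>i\<in>A. f i) = (\<Sum>i\<in>A. moment_functional s (f i))"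
  by (induction A rule: infinite_finite_induct) auto

lemma moment_functional_monom: "moment_functional s (monom c n) = c * s n"
  by (simp add: moment_functional_altdef[of _ n] degree_monom_le if_distrib[of "\<lambda>x. x * _"]
      cong: if_cong)

text \<open>The three-term recurrence of an even weight: there is no diagonal Jacobi coefficient,
  and the remaining one is a ratio of successive squared norms, that is, a Volterra variable.
  Differentiability in the moments follows by induction along it. For arbitrary \<open>s\<close> it
  is a formal recursion (with x / 0 = 0); orthogonality comes with
  \<open>even_definite_moments\<close>.\<close>

fun orthopoly :: "(nat \<Rightarrow> real) \<Rightarrow> nat \<Rightarrow> real poly" where
  "orthopoly s 0 = 1"
| "orthopoly s (Suc 0) = [:0, 1:]"
| "orthopoly s (Suc (Suc n)) = pCons 0 (orthopoly s (Suc n)) -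
     Polynomial.smult (moment_functional s (orthopoly s (Suc n) * orthopoly s (Suc n)) /
            moment_functional s (orthopoly s n * orthopoly s n)) (orthopoly s n)"

definition orthopoly_norm :: "(nat \<Rightarrow> real) \<Rightarrow> nat \<Rightarrow> real" where
  "orthopoly_norm s n = moment_functional s (orthopoly s n * orthopoly s n)"

lemma orthopoly_monic_degree: "degree (orthopoly s n) = n \<and> lead_coeff (orthopoly s n) = 1"
proof (induction s n rule: orthopoly.induct)
  case (3 s n)
  let ?p = "pCons 0 (orthopoly s (Suc n))"
  let ?r = "Polynomial.smult (moment_functional s (orthopoly s (Suc n) * orthopoly s (Suc n)) /
            moment_functional s (orthopoly s n * orthopoly s n)) (orthopoly s n)"
  have nz: "orthopoly s (Suc n) \<noteq> 0" using 3(1) by auto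
  have p: "degree ?p = Suc (Suc n)" "lead_coeff ?p = 1" using 3(1) nz by auto
  have r: "degree ?r < Suc (Suc n)"
    by (rule le_less_trans[OF degree_smult_le]) (use 3 in simp)
  have d: "degree (?p - ?r) = Suc (Suc n)"
    using degree_add_eq_left[of "- ?r" ?p] p r by simp
  have "coeff ?r (Suc (Suc n)) = 0" using r by (rule coeff_eq_0)
  hence "coeff (?p - ?r) (Suc (Suc n)) = 1" using p by (metis coeff_diff diff_zero)
  thus ?case using d by simp
qed auto

lemma degree_orthopoly [simp]: "degree (orthopoly s n) = n"
  and coeff_orthopoly_self [simp]: "coeff (orthopoly s n) n = 1"
  using orthopoly_monic_degree[of s n] by auto

lemma orthopoly_nonzero [simp]: "orthopoly s n \<noteq> 0"
  using coeff_orthopoly_self[of s n] by (metis coeff_0 zero_neq_one)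

text \<open>Evenness of the weight seen on coefficients: multiplication by X flips the parity, and
  the subtracted term has index lower by two. Used for \<open>L_X_square\<close>.\<close>

lemma coeff_orthopoly_parity: "coeff (orthopoly s n) i \<noteq> 0 \<Longrightarrow> even i \<longleftrightarrow> even n"
proof (induction s n arbitrary: i rule: orthopoly.induct)
  case (1 s) thus ?case by (cases i) auto
next
  case (2 s) thus ?case by (cases i) (auto simp: coeff_pCons split: nat.splits)
next
  case (3 s n)
  have IH: "\<And>j. coeff (orthopoly s (Suc n)) j \<noteq> 0 \<Longrightarrow> even j \<longleftrightarrow> even (Suc n)"
    "\<And>j. coeff (orthopoly s n) j \<noteq> 0 \<Longrightarrow> even j \<longleftrightarrow> even n"
    using "3.IH" by blast+
  from "3.prems" have "coeff (pCons 0 (orthopoly s (Suc n))) i \<noteq> 0 \<or> coeff (orthopoly s n) i \<noteq> 0"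
    by auto
  thus ?case
  proof
    assume "coeff (pCons 0 (orthopoly s (Suc n))) i \<noteq> 0"
    then obtain j where "i = Suc j" "coeff (orthopoly s (Suc n)) j \<noteq> 0" by (cases i) auto
    thus ?case using IH(1)[of j] by auto
  next
    assume "coeff (orthopoly s n) i \<noteq> 0"
    thus ?case using IH(2)[of i] by auto
  qed
qed

declare orthopoly.simps(3) [simp del]

section \<open>Orthogonality, minimality and Hankel determinants\<close>

locale even_definite_moments =
  fixes s :: "nat \<Rightarrow> real"
  assumes odd_zero: "odd k \<Longrightarrow> s k = 0"
    and definite: "p \<noteq> 0 \<Longrightarrow> moment_functional s (p * p) > 0"
begin

abbreviation "L \<equiv> moment_functional s"
abbreviation "P \<equiv> orthopoly s"
abbreviation "h \<equiv> orthopoly_norm s"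

lemma h_pos [simp]: "h n > 0"
  unfolding orthopoly_norm_def by (rule definite) simp

lemma P_rec: "pCons 0 (P (Suc n)) = P (Suc (Suc n)) + Polynomial.smult (h (Suc n) / h n) (P n)"
  by (simp add: orthopoly_norm_def orthopoly.simps(3))

text \<open>The vanishing diagonal Jacobi coefficient: by parity the square of \<open>P n\<close>
  has only even powers, so its product with X meets only odd moments.\<close>

lemma L_X_square: "L (pCons 0 (P n) * P n) = 0"
proof -
  have "coeff (pCons 0 (P n) * P n) i * s i = 0" for i
  proof (cases "even i")
    case True
    have "coeff (pCons 0 (P n) * P n) i = 0"
    proof (cases i)
      case (Suc j)
      have "coeff (P n * P n) j = 0"
        unfolding coeff_mult
      proof (rule sum.neutral, rule ballI)
        fix k assume k: "k \<in> {..j}"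
        show "coeff (P n) k * coeff (P n) (j - k) = 0"
        proof (rule ccontr)
          assume "coeff (P n) k * coeff (P n) (j - k) \<noteq> 0"
          hence "even k \<longleftrightarrow> even n" "even (j - k) \<longleftrightarrow> even n"
            using coeff_orthopoly_parity[of s n k] coeff_orthopoly_parity[of s n "j - k"] by auto
          with k have "even (k + (j - k))" unfolding even_add by blast
          moreover have "k + (j - k) = j" using k by simp
          ultimately have "even j" by metis
          with True Suc show False by simp
        qed
      qed
      thus ?thesis using Suc by simp
    qed simp
    thus ?thesis by simp
  qed (simp add: odd_zero)
  thus ?thesis unfolding moment_functional_def by (intro sum.neutral) blast
qed

text \<open>The recurrence for \<open>P n\<close> reduces the claim to pairs of smaller index. At i
  = n - 1 \<open>L_X_square\<close> applies; at i = n - 2 the coefficient in the recurrence is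
  exactly the one for which the two terms cancel; below that, X is moved to the other
  factor.\<close>

lemma L_orthogonal: "i < n \<Longrightarrow> L (P i * P n) = 0"
proof (induction n arbitrary: i rule: less_induct)
  case (less n)
  show ?case
  proof (cases n)
    case 0 thus ?thesis using less by simp
  next
    case (Suc m)
    show ?thesis
    proof (cases m)
      case 0
      hence "i = 0" "n = 1" using less.prems Suc by auto
      thus ?thesis using L_X_square[of 0] by (simp add: one_pCons)
    next
      case (Suc k)
      note n = \<open>n = Suc m\<close>[unfolded Suc]
      have IH: "j < l \<Longrightarrow> l \<le> Suc k \<Longrightarrow> L (P j * P l) = 0" for j l
        using less.IH[of l j] n by auto
      have Pn: "P n = pCons 0 (P (Suc k)) - Polynomial.smult (h (Suc k) / h k) (P k)"
        using n P_rec[of k] by simp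
      have eq: "L (P i * P n) = L (pCons 0 (P i) * P (Suc k)) - h (Suc k) / h k * L (P i * P k)"
        unfolding Pn by (simp add: algebra_simps)
      consider "i = Suc k" | "i = k" | "i < k" using less.prems n by linarith
      thus ?thesis
      proof cases
        case 1
        thus ?thesis using eq L_X_square[of "Suc k"] IH[of k "Suc k"] by (simp add: mult.commute)
      next
        case 2
        have "L (pCons 0 (P k) * P (Suc k)) = h (Suc k)"
        proof (cases k)
          case 0 thus ?thesis by (simp add: orthopoly_norm_def one_pCons)
        next
          case (Suc j)
          show ?thesis using IH[of j "Suc k"] Suc P_rec[of j]
            by (simp add: orthopoly_norm_def algebra_simps)
        qed
        thus ?thesis using eq 2 h_pos[of k] by (simp add: orthopoly_norm_def)
      next
        case 3
        have "L (pCons 0 (P i) * P (Suc k)) = 0"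
        proof (cases i)
          case 0 thus ?thesis using IH[of 1 "Suc k"] 3 by (simp add: one_pCons)
        next
          case (Suc j)
          show ?thesis using IH[of j "Suc k"] IH[of "Suc i" "Suc k"] Suc 3 P_rec[of j]
            by (simp add: algebra_simps)
        qed
        thus ?thesis using eq IH[of i k] 3 by simp
      qed
    qed
  qed
qed

text \<open>The hypothesis speaks of coefficients because \<open>degree 0 = 0\<close>: for n = 0 it
  forces q = 0. Removing leading terms expands q in the \<open>P i\<close> with i < n.\<close>

lemma L_lower_degree:
  assumes "\<And>i. i \<ge> n \<Longrightarrow> coeff q i = 0"
  shows "L (q * P n) = 0"
proof -
  have "L (q * P n) = 0" if "m \<le> n" "\<And>i. i \<ge> m \<Longrightarrow> coeff q i = 0" for m q
    using that
  proof (induction m arbitrary: q)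
    case 0
    hence "q = 0" by (intro poly_eqI) auto
    thus ?case by simp
  next
    case (Suc m)
    let ?q = "q - Polynomial.smult (coeff q m) (P m)"
    have c: "coeff ?q i = 0" if "i \<ge> m" for i
      using that Suc.prems(2)[of i] by (cases "i = m") (auto simp: coeff_eq_0)
    have "L (?q * P n) = 0" using Suc.IH[OF _ c] Suc.prems(1) by simp
    moreover have "L (P m * P n) = 0" using L_orthogonal Suc.prems(1) by simp
    ultimately show ?case by (simp add: algebra_simps)
  qed
  from this[of n q] assms show ?thesis by simp
qed

lemma L_square_add_smult:
  "L ((p + Polynomial.smult c q) * (p + Polynomial.smult c q)) = L (p * p) + 2 * c * L (q * p) + c\<^sup>2 * L (q * q)"
proof -
  have "(p + Polynomial.smult c q) * (p + Polynomial.smult c q) =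
      p * p + Polynomial.smult (2 * c) (q * p) + Polynomial.smult (c\<^sup>2) (q * q)"
    by (subst poly_eq_poly_eq_iff[symmetric]) (simp add: fun_eq_iff algebra_simps power2_eq_square)
  thus ?thesis by simp
qed

text \<open>Pythagoras: the difference of two monic polynomials of degree n has lower degree, hence
  is orthogonal to \<open>P n\<close>.\<close>

lemma h_minimal:
  assumes "degree p = n" "lead_coeff p = 1"
  shows "h n \<le> L (p * p)"
proof -
  let ?q = "p - P n"
  have "coeff ?q i = 0" if "i \<ge> n" for i
    using that assms by (cases "i = n") (auto simp: coeff_eq_0)
  hence z: "L (?q * P n) = 0" by (rule L_lower_degree)
  have "p * p = P n * P n + (?q * P n + ?q * P n) + ?q * ?q"
    by (simp add: algebra_simps)
  hence "L (p * p) = h n + L (?q * ?q)" using z by (simp add: orthopoly_norm_def mult.commute)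
  moreover have "L (?q * ?q) \<ge> 0" using definite[of ?q] by (cases "?q = 0") auto
  ultimately show ?thesis by simp
qed

text \<open>Pythagoras for the recurrence, which splits X times \<open>P n\<close> into orthogonal
  multiples of \<open>P (n + 1)\<close> and \<open>P (n - 1)\<close>. The case n = 0 is the source
  of the boundary condition a_(-1) = 0.\<close>

lemma L_XX_square:
  "L ([:0,0,1:] * (P n * P n)) = h (Suc n) + (if n = 0 then 0 else h n * h n / h (n - 1))"
proof (cases n)
  case 0 thus ?thesis by (simp add: orthopoly_norm_def one_pCons)
next
  case (Suc k)
  have "[:0,0,1:] * (P n * P n) = pCons 0 (P n) * pCons 0 (P n)" by simp
  also have "L \<dots> = h (Suc n) + (h n / h k)\<^sup>2 * h k"
    using L_orthogonal[of k "Suc n"] unfolding Suc P_rec[of k] L_square_add_smult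
    by (simp add: orthopoly_norm_def)
  also have "(h n / h k)\<^sup>2 * h k = h n * h n / h k"
    using h_pos[of k] by (simp add: power2_eq_square)
  finally show ?thesis using Suc by simp
qed

lemma L_bilinear:
  assumes "degree p < m" "degree q < m"
  shows "L (p * q) = (\<Sum>i<m. \<Sum>j<m. coeff p i * coeff q j * s (i + j))"
proof -
  have ex: "r = (\<Sum>i<m. monom (coeff r i) i)" if "degree r < m" for r :: "real poly"
    using that poly_as_sum_of_monoms'[of r "m - 1"] by (cases m) (auto simp: lessThan_Suc_atMost)
  have "L (p * q) = L ((\<Sum>i<m. monom (coeff p i) i) * (\<Sum>j<m. monom (coeff q j) j))"
    using ex[OF assms(1)] ex[OF assms(2)] by simp
  also have "\<dots> = (\<Sum>i<m. \<Sum>j<m. coeff p i * coeff q j * s (i + j))"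
    by (simp add: sum_product mult_monom moment_functional_sum moment_functional_monom)
  finally show ?thesis .
qed

text \<open>The Gram matrix of the orthogonal polynomials is diagonal, and it is \<open>U H U\<^sup>T\<close> for the
  unitriangular matrix \<open>U\<close> of their coefficients and the Hankel matrix \<open>H\<close>.\<close>

lemma hankel_det_eq_prod: "hankel_det s m = (\<Prod>k<m. h k)"
proof -
  define H where "H = mat m m (\<lambda>(i, j). s (i + j))"
  define U where "U = mat m m (\<lambda>(i, j). coeff (P i) j)"
  define D where "D = mat m m (\<lambda>(i, j). L (P i * P j))"
  have [simp]: "H \<in> carrier_mat m m" "U \<in> carrier_mat m m" "D \<in> carrier_mat m m"
    "transpose_mat U \<in> carrier_mat m m" "U * H \<in> carrier_mat m m"
    by (auto simp: H_def U_def D_def)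
  have "D = U * H * transpose_mat U"
  proof (rule eq_matI)
    fix i j assume "i < dim_row (U * H * transpose_mat U)" "j < dim_col (U * H * transpose_mat U)"
    hence ij: "i < m" "j < m" by (auto simp: U_def)
    have "(U * H * transpose_mat U) $$ (i, j) =
        (\<Sum>l<m. (\<Sum>k<m. coeff (P i) k * s (k + l)) * coeff (P j) l)"
      using ij by (simp add: U_def H_def scalar_prod_def atLeast0LessThan)
    also have "\<dots> = (\<Sum>k<m. \<Sum>l<m. coeff (P i) k * coeff (P j) l * s (k + l))"
      by (subst sum.swap) (simp add: sum_distrib_left sum_distrib_right algebra_simps)
    also have "\<dots> = L (P i * P j)" using ij by (subst L_bilinear[of _ m]) auto
    finally show "D $$ (i, j) = (U * H * transpose_mat U) $$ (i, j)"
      using ij by (simp add: D_def)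
  qed (auto simp: D_def U_def)
  hence "Determinant.det D = Determinant.det U * Determinant.det H * Determinant.det U"
    by (simp add: det_mult[of _ m] det_transpose[of _ m])
  moreover have "Determinant.det U = 1"
    by (subst det_lower_triangular[of m])
       (auto simp: U_def coeff_eq_0 prod_list_diag_prod intro!: prod.neutral)
  moreover have "Determinant.det D = (\<Prod>k<m. h k)"
    by (subst det_lower_triangular[of m])
       (auto simp: D_def L_orthogonal prod_list_diag_prod orthopoly_norm_def
         atLeast0LessThan)
  ultimately show ?thesis by (simp add: hankel_det_def H_def)
qed

end

section \<open>Time derivatives and the Volterra equations\<close>

lemma has_real_derivative_coeff_mult:
  assumes "\<And>i. ((\<lambda>t. coeff (p t) i) has_real_derivative coeff p' i) (at t)"
    and "\<And>i. ((\<lambda>t. coeff (q t) i) has_real_derivative coeff q' i) (at t)"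
  shows "((\<lambda>t. coeff (p t * q t) i) has_real_derivative coeff (p' * q t + p t * q') i) (at t)"
  unfolding coeff_mult coeff_add
  by (rule derivative_eq_intros assms refl | simp add: sum.distrib algebra_simps)+

text \<open>Product rule in which the time dependence of the functional costs a factor X^2: the
  hypothesis on \<open>s\<close> is what differentiating exp (x^2 t) under the integral gives. The
  uniform degree bound keeps the summation range fixed.\<close>

lemma has_real_derivative_moment_functional:
  assumes s: "\<And>k. ((\<lambda>t. s t k) has_real_derivative s t (k + 2)) (at t)"
    and p: "\<And>i. ((\<lambda>t. coeff (p t) i) has_real_derivative coeff p' i) (at t)"
    and deg: "\<And>t. degree (p t) \<le> N"
  shows "((\<lambda>t. moment_functional (s t) (p t)) has_real_derivative
      moment_functional (s t) ([:0,0,1:] * p t) + moment_functional (s t) p') (at t)"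
proof -
  have deg': "degree p' \<le> N"
  proof (rule degree_le, safe)
    fix i assume "i > N"
    hence "(\<lambda>t. coeff (p t) i) = (\<lambda>_. 0)" using deg by (auto simp: fun_eq_iff intro!: coeff_eq_0 le_less_trans[OF deg])
    hence "((\<lambda>_. 0) has_real_derivative coeff p' i) (at t)" using p[of i] by simp
    thus "coeff p' i = 0" using DERIV_unique DERIV_const by blast
  qed
  have "((\<lambda>t. \<Sum>i\<le>N. coeff (p t) i * s t i) has_real_derivative
     (\<Sum>i\<le>N. coeff p' i * s t i + s t (i + 2) * coeff (p t) i)) (at t)"
    by (intro DERIV_sum DERIV_mult s p)
  moreover have "moment_functional (s t) ([:0,0,1:] * p t) = (\<Sum>i\<le>N. coeff (p t) i * s t (i + 2))"
  proof -
    have "[:0,0,1:] * p t = pCons 0 (pCons 0 (p t))" by simp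
    hence "moment_functional (s t) ([:0,0,1:] * p t) =
        (\<Sum>i\<le>Suc (Suc N). coeff (pCons 0 (pCons 0 (p t))) i * s t i)"
      by (metis moment_functional_altdef degree_pCons_le Suc_le_mono deg le_trans)
    also have "\<dots> = (\<Sum>i\<le>N. coeff (p t) i * s t (i + 2))"
      by (simp add: sum.atMost_Suc_shift del: sum.atMost_Suc)
    finally show ?thesis .
  qed
  ultimately show ?thesis
    by (simp add: moment_functional_altdef[OF deg] moment_functional_altdef[OF deg'] sum.distrib algebra_simps)
qed

text \<open>The recurrence coefficients are quotients of norms with nonzero denominator, so
  differentiability passes up the recurrence. Only existence of the derivative polynomial is
  recorded: its form disappears by orthogonality in \<open>orthopoly_norm_deriv\<close>.\<close>

lemma orthopoly_differentiable:
  fixes s :: "real \<Rightarrow> nat \<Rightarrow> real"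
  assumes def: "\<And>t. even_definite_moments (s t)"
    and s: "\<And>t k. ((\<lambda>t. s t k) has_real_derivative s t (k + 2)) (at t)"
  shows "\<exists>q. \<forall>i. ((\<lambda>t. coeff (orthopoly (s t) n) i) has_real_derivative coeff q i) (at t)"
proof (induction n rule: less_induct)
  case (less n)
  consider "n = 0" | "n = 1" | m where "n = Suc (Suc m)"
    by (metis One_nat_def not0_implies_Suc)
  thus ?case
  proof cases
    case 3
    obtain q1 where q1: "\<And>i. ((\<lambda>t. coeff (orthopoly (s t) (Suc m)) i) has_real_derivative coeff q1 i) (at t)"
      using less[of "Suc m"] 3 by auto
    obtain q0 where q0: "\<And>i. ((\<lambda>t. coeff (orthopoly (s t) m) i) has_real_derivative coeff q0 i) (at t)"
      using less[of m] 3 by auto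
    have norm: "\<exists>d. ((\<lambda>t. orthopoly_norm (s t) k) has_real_derivative d) (at t)"
      if "\<And>i. ((\<lambda>t. coeff (orthopoly (s t) k) i) has_real_derivative coeff q i) (at t)" for k q
      unfolding orthopoly_norm_def
      using has_real_derivative_moment_functional[of s t "\<lambda>t. orthopoly (s t) k * orthopoly (s t) k",
          OF s has_real_derivative_coeff_mult[OF that that], where N = "k + k"]
      by (auto simp: degree_mult_eq)
    obtain d1 where d1: "((\<lambda>t. orthopoly_norm (s t) (Suc m)) has_real_derivative d1) (at t)"
      using norm[OF q1] by auto
    obtain d0 where d0: "((\<lambda>t. orthopoly_norm (s t) m) has_real_derivative d0) (at t)"
      using norm[OF q0] by auto
    have "orthopoly_norm (s t) m \<noteq> 0" using even_definite_moments.h_pos[OF def, of t m] by simp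
    from DERIV_divide[OF d1 d0 this] obtain c where
      c: "((\<lambda>t. orthopoly_norm (s t) (Suc m) / orthopoly_norm (s t) m) has_real_derivative c) (at t)"
      by auto
    define q where "q = pCons 0 q1 - (Polynomial.smult c (orthopoly (s t) m) +
      Polynomial.smult (orthopoly_norm (s t) (Suc m) / orthopoly_norm (s t) m) q0)"
    have "((\<lambda>t. coeff (orthopoly (s t) n) i) has_real_derivative coeff q i) (at t)" for i
    proof -
      have "((\<lambda>t. coeff (pCons 0 (orthopoly (s t) (Suc m))) i) has_real_derivative coeff (pCons 0 q1) i) (at t)"
        using q1 by (cases i) auto
      from DERIV_diff[OF this DERIV_mult[OF c q0[of i]]] show ?thesis
        unfolding 3 orthopoly.simps(3) q_def orthopoly_norm_def by (simp add: algebra_simps)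
    qed
    thus ?thesis by blast
  qed (auto intro!: exI[of _ 0])
qed

lemma orthopoly_norm_deriv:
  fixes s :: "real \<Rightarrow> nat \<Rightarrow> real"
  assumes def: "\<And>t. even_definite_moments (s t)"
    and s: "\<And>t k. ((\<lambda>t. s t k) has_real_derivative s t (k + 2)) (at t)"
  defines "h \<equiv> \<lambda>n t. orthopoly_norm (s t) n"
  shows "(h n has_real_derivative h (Suc n) t + (if n = 0 then 0 else h n t * h n t / h (n - 1) t)) (at t)"
proof -
  interpret even_definite_moments "s t" by (rule def)
  obtain q where q: "\<And>i. ((\<lambda>t. coeff (orthopoly (s t) n) i) has_real_derivative coeff q i) (at t)"
    using orthopoly_differentiable[of s, OF def s] by blast
  \<comment> \<open>The leading coefficient is constantly 1, so the derivative has degree below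
    n.\<close>
  have "coeff q i = 0" if "i \<ge> n" for i
  proof -
    have "(\<lambda>t. coeff (orthopoly (s t) n) i) = (\<lambda>_. if i = n then 1 else 0)"
      using that by (auto simp: fun_eq_iff coeff_eq_0)
    with q[of i] show ?thesis using DERIV_unique DERIV_const by metis
  qed
  hence "L (q * P n) = 0" by (rule L_lower_degree)
  hence z: "L (q * P n + P n * q) = 0" by (simp add: mult.commute)
  have "(h n has_real_derivative L ([:0,0,1:] * (P n * P n)) + L (q * P n + P n * q)) (at t)"
    unfolding h_def orthopoly_norm_def
    by (rule has_real_derivative_moment_functional[of s t "\<lambda>t. orthopoly (s t) n * orthopoly (s t) n",
          OF s has_real_derivative_coeff_mult[OF q q], where N = "n + n"])
       (auto simp: degree_mult_eq)
  thus ?thesis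
    unfolding L_XX_square z h_def add_0_right .
qed

text \<open>By \<open>orthopoly_norm_deriv\<close> the logarithmic derivative of h n is a n + a (n -
  1). That of h (n + 1) / h n is therefore the difference of a (n + 1) + a n and a n + a (n - 1),
  where a n cancels.\<close>

lemma volterra_orthopoly_norm:
  fixes s :: "real \<Rightarrow> nat \<Rightarrow> real"
  assumes def: "\<And>t. even_definite_moments (s t)"
    and s: "\<And>t k. ((\<lambda>t. s t k) has_real_derivative s t (k + 2)) (at t)"
  defines "a \<equiv> \<lambda>n t. orthopoly_norm (s t) (n + 1) / orthopoly_norm (s t) n"
  shows "(a n has_real_derivative a n t * (a (n + 1) t - (if n = 0 then 0 else a (n - 1) t))) (at t)"
proof -
  have pos: "orthopoly_norm (s t) k > 0" for k
    using even_definite_moments.h_pos[OF def] by blast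
  note D = orthopoly_norm_deriv[of s, OF def s, where t = t]
  have "orthopoly_norm (s t) n \<noteq> 0" using pos[of n] by simp
  from DERIV_divide[OF D[of "n + 1"] D[of n] this] show ?thesis
    unfolding a_def
    by (rule DERIV_cong) (use pos[of n] pos[of "n + 1"] pos[of "n - 1"] in
        \<open>cases n, auto simp: field_simps\<close>)
qed

section \<open>Jensen's inequality on the unit circle\<close>

abbreviation circle_measure :: "real measure" where
  "circle_measure \<equiv> restrict_space lborel {0..2 * pi}"

lemma finite_circle_measure: "finite_measure circle_measure"
  by (intro finite_measureI) (simp add: emeasure_restrict_space space_restrict_space)

lemma measure_circle_measure: "measure circle_measure (space circle_measure) = 2 * pi"
  by (simp add: measure_restrict_space space_restrict_space)

lemma integrable_circle_measure:
  fixes f :: "real \<Rightarrow> 'a :: {banach, second_countable_topology}"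
  assumes "continuous_on {0..2 * pi} f"
  shows "integrable circle_measure f"
  using borel_integrable_compact[OF compact_Icc assms]
  by (simp add: integrable_restrict_space set_integrable_def)

lemma integral_circle_measure:
  fixes f :: "real \<Rightarrow> real"
  assumes "continuous_on {0..2 * pi} f"
  shows "integral\<^sup>L circle_measure f = integral {0..2 * pi} f"
proof -
  have "set_integrable lborel {0..2 * pi} f"
    unfolding set_integrable_def using borel_integrable_compact[OF compact_Icc assms] by simp
  from set_borel_integral_eq_integral(2)[OF this] show ?thesis
    by (simp add: integral_restrict_space set_lebesgue_integral_def)
qed

lemma norm_one_minus_cis_pos:
  assumes "cmod b < 1"
  shows "cmod (1 - b * cis t) > 0"
proof -
  have "cmod (b * cis t) < 1" using assms by (simp add: norm_mult)
  hence "b * cis t \<noteq> 1" by auto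
  thus ?thesis by simp
qed

text \<open>Mean value property of the harmonic function ln |1 - b z|, which is 0 at the centre. It
  is read off from Cauchy's formula for Ln (1 - b z); the principal branch is holomorphic because 1
  - b z has positive real part on the closed disc.\<close>

lemma integral_ln_norm_one_minus_cis:
  assumes "cmod b < 1"
  shows "integral\<^sup>L circle_measure (\<lambda>t. ln (cmod (1 - b * cis t))) = 0"
proof -
  let ?f = "\<lambda>z. Ln (1 - b * z)"
  have re: "1 - b * z \<notin> \<real>\<^sub>\<le>\<^sub>0" if "z \<in> cball 0 1" for z
  proof -
    have "cmod (b * z) \<le> cmod b * 1" unfolding norm_mult using that by (intro mult_left_mono) auto
    hence "cmod (b * z) < 1" using assms by simp
    hence "Re (b * z) < 1" using complex_Re_le_cmod[of "b * z"] by linarith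
    thus ?thesis by (auto simp: complex_nonpos_Reals_iff)
  qed
  have "?f holomorphic_on cball 0 1"
    using re by (auto intro!: holomorphic_intros)
  from Cauchy_integral_circlepath_simple[OF this, of 0]
  have "((\<lambda>u. ?f u / u) has_contour_integral 0) (circlepath 0 1)" by simp
  hence "((\<lambda>t. ?f (cis t) / cis t * \<i> * cis t) has_integral 0) {0..2 * pi}"
    unfolding circlepath_def by (subst (asm) has_contour_integral_part_circlepath_iff) auto
  hence "((\<lambda>t. ?f (cis t) * \<i>) has_integral 0) {0..2 * pi}" by simp
  from has_integral_linear[OF this bounded_linear_Im]
  have "((\<lambda>t. ln (cmod (1 - b * cis t))) has_integral 0) {0..2 * pi}"
    using norm_one_minus_cis_pos[OF assms] by (simp add: o_def)
  hence "integral {0..2 * pi} (\<lambda>t. ln (cmod (1 - b * cis t))) = 0" by (rule integral_unique)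
  moreover have "continuous_on {0..2 * pi} (\<lambda>t. ln (cmod (1 - b * cis t)))"
    using norm_one_minus_cis_pos[OF assms] by (intro continuous_intros) (auto simp: less_imp_neq[symmetric])
  ultimately show ?thesis by (simp add: integral_circle_measure)
qed

text \<open>Each factor has logarithmic mean 0, so the geometric mean of the integrand is that of V
  alone. \<open>V t \<le> 1\<close> supplies integrability of the right-hand side.\<close>

lemma jensen_lower_bound_open:
  fixes V :: "real \<Rightarrow> real" and bs :: "complex list"
  assumes V [measurable]: "V \<in> borel_measurable circle_measure"
    and pos: "\<And>t. 0 < V t" and le1: "\<And>t. V t \<le> 1"
    and int: "integrable circle_measure (\<lambda>t. ln (V t))"
    and b: "\<And>b. b \<in> set bs \<Longrightarrow> cmod b < 1"
  shows "2 * pi * exp ((\<integral>t. ln (V t) \<partial>circle_measure) / (2 * pi)) \<le>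
    (\<integral>t. (\<Prod>b\<leftarrow>bs. cmod (1 - b * cis t))\<^sup>2 * V t \<partial>circle_measure)"
proof -
  interpret finite_measure circle_measure by (rule finite_circle_measure)
  define c where "c = (\<integral>t. ln (V t) \<partial>circle_measure) / (2 * pi)"
  let ?p = "\<lambda>t. \<Prod>b\<leftarrow>bs. cmod (1 - b * cis t)"
  have p: "?p t > 0" "ln (?p t) = (\<Sum>b\<leftarrow>bs. ln (cmod (1 - b * cis t)))" for t
    using b
  proof (induction bs)
    case (Cons a bs)
    { case 1 show ?case using Cons.IH(1) 1 norm_one_minus_cis_pos[of a t] by simp }
    { case 2
      have "(\<Prod>b\<leftarrow>bs. cmod (1 - b * cis t)) > 0" using Cons.IH(1) 2 by simp
      thus ?case using Cons.IH(2) 2 norm_one_minus_cis_pos[of a t] by (simp add: ln_mult_pos) }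
  qed auto
  have cont: "continuous_on {0..2 * pi} ?p"
    by (induction bs) (auto intro!: continuous_intros)
  have lnint: "integrable circle_measure (\<lambda>t. ln (?p t)) \<and> (\<integral>t. ln (?p t) \<partial>circle_measure) = 0"
    unfolding p(2) using b
  proof (induction bs)
    case (Cons a bs)
    have "integrable circle_measure (\<lambda>t. ln (cmod (1 - a * cis t)))"
      using norm_one_minus_cis_pos[of a] Cons.prems
      by (intro integrable_circle_measure continuous_intros) (auto simp: less_imp_neq[symmetric])
    thus ?case using Cons integral_ln_norm_one_minus_cis[of a] by simp
  qed auto
  \<comment> \<open>Jensen as a tangent line estimate: exp y \<ge> exp c * (1 + y - c), where y is
    the logarithm of the integrand and c its mean, so that y - c integrates to 0.\<close>
  have "(\<integral>t. exp c * (1 + 2 * ln (?p t) + ln (V t) - c) \<partial>circle_measure) \<le>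
        (\<integral>t. (?p t)\<^sup>2 * V t \<partial>circle_measure)"
  proof (rule integral_mono)
    show "integrable circle_measure (\<lambda>t. exp c * (1 + 2 * ln (?p t) + ln (V t) - c))"
      using lnint int by simp
    show "integrable circle_measure (\<lambda>t. (?p t)\<^sup>2 * V t)"
    proof (rule Bochner_Integration.integrable_bound)
      show "integrable circle_measure (\<lambda>t. (?p t)\<^sup>2)"
        using cont by (intro integrable_circle_measure continuous_intros)
      show "AE t in circle_measure. norm ((?p t)\<^sup>2 * V t) \<le> norm ((?p t)\<^sup>2)"
        using le1 pos by (intro AE_I2) (simp add: abs_mult mult_left_le less_imp_le)
      have "?p \<in> borel_measurable circle_measure"
        using integrable_circle_measure[OF cont] by simp
      thus "(\<lambda>t. (?p t)\<^sup>2 * V t) \<in> borel_measurable circle_measure" by simp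
    qed
    fix t
    let ?y = "(?p t)\<^sup>2 * V t"
    have y: "?y > 0" using p(1)[of t] pos[of t] by (intro mult_pos_pos zero_less_power)
    have "ln ?y = ln ((?p t)\<^sup>2) + ln (V t)"
      using p(1)[of t] pos[of t] by (intro ln_mult_pos zero_less_power)
    also have "ln ((?p t)\<^sup>2) = 2 * ln (?p t)" by (simp only: ln_realpow of_nat_numeral)
    finally have "ln ?y = 2 * ln (?p t) + ln (V t)" .
    moreover have "1 + (ln ?y - c) \<le> exp (ln ?y - c)" by (rule exp_ge_add_one_self)
    hence "exp c * (1 + (ln ?y - c)) \<le> exp c * exp (ln ?y - c)" by simp
    hence "exp c * (1 + (ln ?y - c)) \<le> ?y" using y by (simp add: exp_diff)
    ultimately show "exp c * (1 + 2 * ln (?p t) + ln (V t) - c) \<le> ?y" by (simp add: algebra_simps)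
  qed
  also have "(\<integral>t. exp c * (1 + 2 * ln (?p t) + ln (V t) - c) \<partial>circle_measure) = exp c * (2 * pi)"
  proof -
    have "(\<integral>t. exp c * (1 + 2 * ln (?p t) + ln (V t) - c) \<partial>circle_measure) =
        exp c * (\<integral>t. (1 - c) + (2 * ln (?p t) + ln (V t)) \<partial>circle_measure)"
      by (subst integral_mult_right_zero[symmetric]) (simp add: algebra_simps)
    also have "(\<integral>t. (1 - c) + (2 * ln (?p t) + ln (V t)) \<partial>circle_measure) =
        (\<integral>t. 1 - c \<partial>circle_measure) + ((\<integral>t. 2 * ln (?p t) \<partial>circle_measure) + (\<integral>t. ln (V t) \<partial>circle_measure))"
      using lnint int by (subst Bochner_Integration.integral_add | simp)+
    also have "(\<integral>t. 2 * ln (?p t) \<partial>circle_measure) = 0"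
      using lnint by (subst integral_mult_right_zero) simp
    also have "(\<integral>t. 1 - c \<partial>circle_measure) = 2 * pi * (1 - c)"
      using measure_circle_measure by (subst lebesgue_integral_const) simp
    also have "(\<integral>t. ln (V t) \<partial>circle_measure) = 2 * pi * c" by (simp add: c_def)
    finally show ?thesis by (simp add: algebra_simps)
  qed
  finally show ?thesis by (simp add: c_def mult.commute)
qed

text \<open>For |b| = 1 a factor vanishes on the circle. The b are therefore contracted by r n < 1
  and dominated convergence is used; each factor stays at most 2, whence the constant
  majorant.\<close>

lemma jensen_lower_bound_closed:
  fixes V :: "real \<Rightarrow> real" and bs :: "complex list"
  assumes V [measurable]: "V \<in> borel_measurable circle_measure"
    and pos: "\<And>t. 0 < V t" and le1: "\<And>t. V t \<le> 1"
    and int: "integrable circle_measure (\<lambda>t. ln (V t))"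
    and b: "\<And>b. b \<in> set bs \<Longrightarrow> cmod b \<le> 1"
  shows "2 * pi * exp ((\<integral>t. ln (V t) \<partial>circle_measure) / (2 * pi)) \<le>
    (\<integral>t. (\<Prod>b\<leftarrow>bs. cmod (1 - b * cis t))\<^sup>2 * V t \<partial>circle_measure)"
proof -
  interpret finite_measure circle_measure by (rule finite_circle_measure)
  define r where "r n = 1 - 1 / (real n + 1)" for n :: nat
  have r: "r \<longlonglongrightarrow> 1" unfolding r_def by real_asymp
  have r01: "0 \<le> r n" "r n < 1" for n unfolding r_def by (auto simp: field_simps)
  let ?p = "\<lambda>bs t. \<Prod>b\<leftarrow>bs. cmod (1 - b * cis t)"
  let ?q = "\<lambda>n. map (\<lambda>b. complex_of_real (r n) * b) bs"
  have lim: "(\<lambda>n. \<integral>t. (?p (?q n) t)\<^sup>2 * V t \<partial>circle_measure) \<longlonglongrightarrow> (\<integral>t. (?p bs t)\<^sup>2 * V t \<partial>circle_measure)"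
  proof (rule integral_dominated_convergence[where w = "\<lambda>_. (2 ^ length bs)\<^sup>2"])
    have cont: "continuous_on {0..2 * pi} (?p bs)" for bs
      by (induction bs) (auto intro!: continuous_intros)
    have [measurable]: "?p bs \<in> borel_measurable circle_measure" for bs
      using integrable_circle_measure[OF cont] by simp
    show "(\<lambda>t. (?p bs t)\<^sup>2 * V t) \<in> borel_measurable circle_measure"
      "(\<lambda>t. (?p (?q n) t)\<^sup>2 * V t) \<in> borel_measurable circle_measure" for n
      by measurable
    have "(\<lambda>n. ?p (?q n) t) \<longlonglongrightarrow> ?p bs t" for t
    proof (induction bs)
      case (Cons a bs)
      have "(\<lambda>n. cmod (1 - complex_of_real (r n) * a * cis t)) \<longlonglongrightarrow> cmod (1 - complex_of_real 1 * a * cis t)"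
        by (intro tendsto_intros r)
      from tendsto_mult[OF this Cons] show ?case by simp
    qed auto
    thus "AE t in circle_measure. (\<lambda>n. (?p (?q n) t)\<^sup>2 * V t) \<longlonglongrightarrow> (?p bs t)\<^sup>2 * V t"
      by (intro AE_I2 tendsto_intros)
    have bound: "0 \<le> ?p (?q n) t \<and> ?p (?q n) t \<le> 2 ^ length bs" for n t
      using b
    proof (induction bs)
      case (Cons a bs)
      have "cmod (complex_of_real (r n) * a * cis t) = r n * cmod a"
        using r01 by (simp add: norm_mult)
      also have "\<dots> \<le> 1 * 1" using r01[of n] Cons.prems by (intro mult_mono) auto
      finally have "cmod (1 - complex_of_real (r n) * a * cis t) \<le> 2"
        using norm_triangle_ineq4[of 1 "complex_of_real (r n) * a * cis t"] by simp
      thus ?case using Cons by (auto intro!: mult_mono)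
    qed auto
    show "AE t in circle_measure. norm ((?p (?q n) t)\<^sup>2 * V t) \<le> (2 ^ length bs)\<^sup>2" for n
    proof (rule AE_I2)
      fix t
      have "(?p (?q n) t)\<^sup>2 * V t \<le> (2 ^ length bs)\<^sup>2 * 1"
        using bound[where n = n and t = t] le1[of t] pos[of t] by (intro mult_mono power_mono) auto
      thus "norm ((?p (?q n) t)\<^sup>2 * V t) \<le> (2 ^ length bs)\<^sup>2"
        using pos[of t] by (simp add: abs_mult)
    qed
  qed auto
  have "2 * pi * exp ((\<integral>t. ln (V t) \<partial>circle_measure) / (2 * pi)) \<le>
    (\<integral>t. (?p (?q n) t)\<^sup>2 * V t \<partial>circle_measure)" for n
  proof (rule jensen_lower_bound_open[OF V pos le1 int])
    fix b' assume "b' \<in> set (?q n)"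
    then obtain b0 where b0: "b0 \<in> set bs" "b' = complex_of_real (r n) * b0" by auto
    hence "cmod b' \<le> r n * 1" using r01[of n] b by (simp add: norm_mult mult_left_le)
    thus "cmod b' < 1" using r01[of n] by simp
  qed
  thus ?thesis by (intro LIMSEQ_le_const[OF lim]) blast
qed

text \<open>Roots inside the disc are reflected to the outside, which only decreases the modulus on the
  unit circle.\<close>

lemma complex_poly_ge_prod_on_circle:
  fixes Q :: "complex poly"
  assumes "coeff Q 0 = 1"
  obtains bs where "\<And>b. b \<in> set bs \<Longrightarrow> cmod b \<le> 1"
    "\<And>t. (\<Prod>b\<leftarrow>bs. cmod (1 - b * cis t)) \<le> cmod (poly Q (cis t))"
proof -
  obtain root where Q: "Polynomial.smult (lead_coeff Q) (\<Prod>i<degree Q. [:- root i, 1:]) = Q"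
    using complex_poly_decompose'[of Q] by blast
  define n where "n = degree Q"
  have ev: "poly Q z = lead_coeff Q * (\<Prod>i<n. z - root i)" for z
    by (subst Q[symmetric]) (simp add: poly_prod n_def)
  have one: "lead_coeff Q * (\<Prod>i<n. - root i) = 1"
    using ev[of 0] assms by (simp add: poly_0_coeff_0)
  have nz: "root i \<noteq> 0" if "i < n" for i
  proof
    assume "root i = 0"
    hence "(\<Prod>i<n. - root i) = 0" using that by (intro prod_zero) auto
    with one show False by simp
  qed
  \<comment> \<open>Both choices have modulus at most 1. For a root r inside the disc and |z| = 1,
    |1 - cnj r * z| = |z - r|, which is |r| < 1 times |1 - z / r|.\<close>
  define b where "b i = (if cmod (root i) \<ge> 1 then 1 / root i else cnj (root i))" for i
  have fac: "cmod (1 - b i * z) \<le> cmod (1 - z / root i)" if "i < n" "cmod z = 1" for i z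
  proof (cases "cmod (root i) \<ge> 1")
    case False
    have "1 - cnj (root i) * z = (cnj z - cnj (root i)) * z"
      using that(2) complex_norm_square[of z] by (simp add: algebra_simps)
    hence "cmod (1 - cnj (root i) * z) = cmod (z - root i)"
      using that(2) by (metis complex_cnj_diff complex_mod_cnj mult_cancel_left1 norm_mult mult.commute)
    also have "\<dots> \<le> cmod (z - root i) / cmod (root i)"
      using False nz[OF that(1)] by (simp add: field_simps mult_left_le_one_le)
    also have "\<dots> = cmod (1 - z / root i)"
    proof -
      have "1 - z / root i = (root i - z) / root i"
        using nz[OF that(1)] by (simp add: diff_divide_distrib)
      thus ?thesis by (simp add: norm_divide norm_minus_commute)
    qed
    finally show ?thesis using False by (simp add: b_def)
  qed (simp add: b_def)
  show thesis
  proof (rule that[of "map b [0..<n]"])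
    fix x assume "x \<in> set (map b [0..<n])"
    thus "cmod x \<le> 1" using nz by (auto simp: b_def norm_divide field_simps)
  next
    fix t
    have "(\<Prod>i<n. - root i) \<noteq> 0" using one by (metis mult_zero_right zero_neq_one)
    hence "lead_coeff Q = 1 / (\<Prod>i<n. - root i)"
      using one by (simp add: nonzero_eq_divide_eq)
    hence "poly Q (cis t) = (\<Prod>i<n. (cis t - root i) / (- root i))"
      unfolding ev prod_dividef by simp
    also have "\<dots> = (\<Prod>i<n. 1 - cis t / root i)"
      using nz by (intro prod.cong) (auto simp: field_simps)
    finally have "cmod (poly Q (cis t)) = (\<Prod>i<n. cmod (1 - cis t / root i))"
      by (simp add: prod_norm)
    moreover have "(\<Prod>b\<leftarrow>map b [0..<n]. cmod (1 - b * cis t)) = (\<Prod>i<n. cmod (1 - b i * cis t))"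
      by (simp add: prod.list_conv_set_nth atLeast0LessThan)
    ultimately show "(\<Prod>b\<leftarrow>map b [0..<n]. cmod (1 - b * cis t)) \<le> cmod (poly Q (cis t))"
      using fac by (auto intro!: prod_mono)
  qed
qed

lemma jensen_lower_bound:
  fixes V :: "real \<Rightarrow> real" and Q :: "complex poly"
  assumes V [measurable]: "V \<in> borel_measurable circle_measure"
    and pos: "\<And>t. 0 < V t" and le1: "\<And>t. V t \<le> 1"
    and int: "integrable circle_measure (\<lambda>t. ln (V t))"
    and Q: "coeff Q 0 = 1"
  shows "ennreal (2 * pi * exp ((\<integral>t. ln (V t) \<partial>circle_measure) / (2 * pi))) \<le>
    (\<integral>\<^sup>+t. ennreal ((cmod (poly Q (cis t)))\<^sup>2 * V t) \<partial>circle_measure)"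
proof -
  interpret finite_measure circle_measure by (rule finite_circle_measure)
  obtain bs where bs: "\<And>b. b \<in> set bs \<Longrightarrow> cmod b \<le> 1"
    "\<And>t. (\<Prod>b\<leftarrow>bs. cmod (1 - b * cis t)) \<le> cmod (poly Q (cis t))"
    using complex_poly_ge_prod_on_circle[OF Q] by blast
  let ?p = "\<lambda>t. \<Prod>b\<leftarrow>bs. cmod (1 - b * cis t)"
  have p0: "0 \<le> ?p t" for t by (induction bs) auto
  have I: "integrable circle_measure (\<lambda>t. (cmod (poly Q (cis t)))\<^sup>2 * V t)"
  proof (rule Bochner_Integration.integrable_bound)
    have cont: "continuous_on {0..2 * pi} (\<lambda>t. cmod (poly Q (cis t)))"
      by (intro continuous_intros)
    show "integrable circle_measure (\<lambda>t. (cmod (poly Q (cis t)))\<^sup>2)"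
      using cont by (intro integrable_circle_measure continuous_intros)
    show "AE t in circle_measure. norm ((cmod (poly Q (cis t)))\<^sup>2 * V t) \<le> norm ((cmod (poly Q (cis t)))\<^sup>2)"
      using le1 pos by (intro AE_I2) (simp add: abs_mult mult_left_le less_imp_le)
    have "(\<lambda>t. cmod (poly Q (cis t))) \<in> borel_measurable circle_measure"
      using integrable_circle_measure[OF cont] by simp
    thus "(\<lambda>t. (cmod (poly Q (cis t)))\<^sup>2 * V t) \<in> borel_measurable circle_measure" by simp
  qed
  have "(\<integral>t. (?p t)\<^sup>2 * V t \<partial>circle_measure) \<le> (\<integral>t. (cmod (poly Q (cis t)))\<^sup>2 * V t \<partial>circle_measure)"
    using bs(2) p0 pos by (intro integral_mono' I mult_right_mono power_mono) (auto simp: less_imp_le)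
  with jensen_lower_bound_closed[of V bs, OF V pos le1 int bs(1)]
  show ?thesis
    using pos by (subst nn_integral_eq_integral[OF I]) (auto intro!: ennreal_leI simp: less_imp_le)
qed

section \<open>Polynomials on the interval and on the circle\<close>

text \<open>For \<open>\<bar>x\<bar> \<le> 2\<close> this is the point \<open>\<zeta>\<close> of the upper unit semicircle with \<open>x = \<zeta> + 1/\<zeta>\<close>.\<close>

definition circ :: "real \<Rightarrow> complex" where
  "circ x = Complex (x / 2) (sqrt (4 - x\<^sup>2) / 2)"

definition circ_poly :: "real poly \<Rightarrow> real \<Rightarrow> complex" where
  "circ_poly Q x = poly (map_poly complex_of_real Q) (circ x)"

lemma norm_circ: "x \<in> {-2..2} \<Longrightarrow> cmod (circ x) = 1"
proof -
  assume "x \<in> {-2..2}"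
  hence "x\<^sup>2 \<le> 4" using abs_le_square_iff[of x 2] by auto
  thus ?thesis by (simp add: circ_def cmod_def power_divide field_simps)
qed

lemma circ_cnj: "x \<in> {-2..2} \<Longrightarrow> circ x * cnj (circ x) = 1"
  using complex_norm_square[of "circ x"] norm_circ[of x] by simp

lemma circ_real: "complex_of_real x = circ x + cnj (circ x)"
  by (simp add: circ_def complex_eq_iff)

lemma circ_square: "x \<in> {-2..2} \<Longrightarrow> circ x * complex_of_real x = 1 + circ x ^ 2"
  using circ_cnj[of x] by (simp add: circ_real[of x] algebra_simps power2_eq_square)

lemma continuous_circ [continuous_intros]: "continuous_on S circ"
  unfolding circ_def Complex_eq by (intro continuous_intros) auto

lemma continuous_circ_poly [continuous_intros]: "continuous_on S (circ_poly Q)"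
  unfolding circ_poly_def by (intro continuous_intros)

lemma circ_poly_simps [simp]:
  "circ_poly (P + Q) x = circ_poly P x + circ_poly Q x"
  "circ_poly (P * Q) x = circ_poly P x * circ_poly Q x"
  "circ_poly (Polynomial.smult c P) x = complex_of_real c * circ_poly P x"
  "circ_poly (P ^ n) x = circ_poly P x ^ n"
  "circ_poly [:1,0,1:] x = 1 + circ x ^ 2"
  "circ_poly 0 x = 0"
  "circ_poly (Polynomial.monom c n) x = complex_of_real c * circ x ^ n"
  "circ_poly (pCons c P) x = complex_of_real c + circ x * circ_poly P x"
proof -
  have add: "map_poly complex_of_real (P + Q) = map_poly complex_of_real P + map_poly complex_of_real Q" for P Q
    by (rule poly_eqI) (simp add: coeff_map_poly)
  show "circ_poly (P + Q) x = circ_poly P x + circ_poly Q x" by (simp add: circ_poly_def add)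
  show *: "circ_poly (P * Q) x = circ_poly P x * circ_poly Q x" for P Q
    by (induction P) (simp_all add: circ_poly_def add map_poly_smult map_poly_pCons algebra_simps)
  show "circ_poly (P ^ n) x = circ_poly P x ^ n"
    by (induction n) (simp_all add: *, simp add: circ_poly_def)
qed (simp_all add: circ_poly_def map_poly_smult map_poly_monom poly_monom map_poly_pCons power2_eq_square algebra_simps)

lemma circ_poly_minus [simp]: "circ_poly (- P) x = - circ_poly P x"
  using circ_poly_simps(3)[of "-1" P x] by simp

lemma circ_poly_sum [simp]: "circ_poly (\<Sum>i\<in>A. f i) x = (\<Sum>i\<in>A. circ_poly (f i) x)"
  by (induction A rule: infinite_finite_induct) auto

lemma circ_poly_altdef:
  assumes "degree Q < m"
  shows "circ_poly Q x = (\<Sum>i<m. complex_of_real (coeff Q i) * circ x ^ i)"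
proof -
  have "Q = (\<Sum>i<m. Polynomial.monom (coeff Q i) i)"
    using assms poly_as_sum_of_monoms'[of Q "m - 1"] by (cases m) (auto simp: lessThan_Suc_atMost)
  hence "circ_poly Q x = circ_poly (\<Sum>i<m. Polynomial.monom (coeff Q i) i) x" by simp
  thus ?thesis by simp
qed

text \<open>As zeta x = 1 + zeta^2, zeta^n x^i equals zeta^(n-i) (1 + zeta^2)^i. For i < n a power
  of zeta is left over, so R vanishes at 0: lower-degree changes of a monic polynomial become
  admissible variations of the circle problem Q(0) = 1.\<close>

lemma circ_power_mult_poly:
  assumes "degree S < n"
  obtains R where "coeff R 0 = 0"
    "\<And>x. x \<in> {-2..2} \<Longrightarrow> circ x ^ n * complex_of_real (poly S x) = circ_poly R x"
proof
  let ?R = "\<Sum>i<n. Polynomial.smult (coeff S i) (Polynomial.monom 1 (n - i) * [:1,0,1:] ^ i)"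
  show "coeff ?R 0 = 0" by (auto simp: coeff_sum coeff_monom_mult intro!: sum.neutral)
  fix x :: real assume x: "x \<in> {-2..2}"
  have "poly S x = (\<Sum>i<n. coeff S i * x ^ i)"
    unfolding poly_altdef by (rule sum.mono_neutral_left) (use assms in \<open>auto intro: coeff_eq_0\<close>)
  hence "circ x ^ n * complex_of_real (poly S x) =
      (\<Sum>i<n. complex_of_real (coeff S i) * (circ x ^ n * complex_of_real x ^ i))"
    by (simp add: sum_distrib_left algebra_simps)
  also have "\<dots> = circ_poly ?R x"
    unfolding circ_poly_sum
  proof (rule sum.cong)
    fix i assume "i \<in> {..<n}"
    hence "circ x ^ n = circ x ^ (n - i) * circ x ^ i" by (simp flip: power_add)
    hence "circ x ^ n * complex_of_real x ^ i = circ x ^ (n - i) * (1 + circ x ^ 2) ^ i"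
      using circ_square[OF x] by (simp add: power_mult_distrib[symmetric] mult.assoc)
    thus "complex_of_real (coeff S i) * (circ x ^ n * complex_of_real x ^ i) =
      circ_poly (Polynomial.smult (coeff S i) (Polynomial.monom 1 (n - i) * [:1,0,1:] ^ i)) x"
      by (simp add: power2_eq_square)
  qed simp
  finally show "circ x ^ n * complex_of_real (poly S x) = circ_poly ?R x" .
qed

lemma circ_power_cancel:
  assumes "x \<in> {-2..2}" "i \<le> m"
  shows "circ x ^ m * cnj (circ x) ^ i = circ x ^ (m - i)"
proof -
  have "circ x ^ m = circ x ^ (m - i) * circ x ^ i" using assms(2) by (simp flip: power_add)
  thus ?thesis using circ_cnj[OF assms(1)] by (simp add: mult.assoc flip: power_mult_distrib)
qed

text \<open>Conjugation is inversion on the circle, so B is a reversed polynomial;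
  \<open>degree A < m\<close> leaves a positive power of zeta in every term.\<close>

lemma circ_poly_reverse:
  assumes "degree A < m"
  obtains B where "coeff B 0 = 0"
    "\<And>x. x \<in> {-2..2} \<Longrightarrow> circ x ^ m * cnj (circ_poly A x) = circ_poly B x"
proof
  let ?B = "\<Sum>i<m. Polynomial.monom (coeff A i) (m - i)"
  show "coeff ?B 0 = 0" by (auto simp: coeff_sum intro!: sum.neutral)
  fix x :: real assume x: "x \<in> {-2..2}"
  show "circ x ^ m * cnj (circ_poly A x) = circ_poly ?B x"
  proof -
    have "circ x ^ m * cnj (circ_poly A x) =
        (\<Sum>i<m. complex_of_real (coeff A i) * (circ x ^ m * cnj (circ x) ^ i))"
      unfolding circ_poly_altdef[OF assms] by (simp add: sum_distrib_left mult.left_commute)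
    also have "\<dots> = circ_poly ?B x"
      by (auto intro!: sum.cong simp: circ_power_cancel[OF x])
    finally show ?thesis .
  qed
qed

lemma Re_mult_real: "Re (z * complex_of_real a) = Re z * a"
  and Re_complex_of_real_mult: "Re (complex_of_real a * z) = a * Re z"
  by simp_all

text \<open>C is the rescaled Chebyshev polynomial 2 T_k(x / 2), built by its recurrence. It is
  monic except for k = 0, where it is the constant 2.\<close>

lemma chebyshev_exists:
  "\<exists>C::real poly. degree C \<le> k \<and> (k > 0 \<longrightarrow> coeff C k = 1) \<and>
     (\<forall>x\<in>{-2..2}. poly C x = 2 * Re (circ x ^ k))"
proof (induction k rule: less_induct)
  case (less k)
  consider "k = 0" | "k = 1" | m where "k = Suc (Suc m)"
    by (metis One_nat_def not0_implies_Suc)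
  thus ?case
  proof cases
    case 1 thus ?thesis by (intro exI[of _ "[:2:]"]) auto
  next
    case 2 thus ?thesis by (intro exI[of _ "[:0,1:]"]) (auto simp: circ_def)
  next
    case 3
    obtain D where D: "degree D \<le> Suc m" "coeff D (Suc m) = 1"
      "\<And>x. x \<in> {-2..2} \<Longrightarrow> poly D x = 2 * Re (circ x ^ Suc m)"
      using less[of "Suc m"] 3 by auto
    obtain E where E: "degree E \<le> m" "\<And>x. x \<in> {-2..2} \<Longrightarrow> poly E x = 2 * Re (circ x ^ m)"
      using less[of m] 3 by auto
    have "degree (pCons 0 D - E) \<le> k"
      using D(1) E(1) 3 by (intro degree_diff_le order.trans[OF degree_pCons_le]) auto
    moreover have "coeff (pCons 0 D - E) k = 1" using D(2) E(1) 3 by (simp add: coeff_eq_0)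
    moreover have "poly (pCons 0 D - E) x = 2 * Re (circ x ^ k)" if x: "x \<in> {-2..2}" for x
    proof -
      have "circ x ^ k = circ x ^ Suc m * complex_of_real x - circ x ^ m"
      proof -
        have "circ x ^ Suc m * complex_of_real x = circ x ^ m * (circ x * complex_of_real x)" by simp
        thus ?thesis unfolding circ_square[OF x] by (simp add: 3 power2_eq_square algebra_simps)
      qed
      hence "Re (circ x ^ k) = Re (circ x ^ Suc m) * x - Re (circ x ^ m)"
        by (simp only: minus_complex.sel Re_mult_real)
      thus ?thesis using D(3)[OF x] E(2)[OF x] by (simp add: algebra_simps del: power_Suc)
    qed
    ultimately show ?thesis by blast
  qed
qed

text \<open>The exponents in zeta^(-n) A(zeta) run from -n to n - 1, so only the constant term of A
  reaches degree n. The strict bound 2 n matters: an exponent +n would add to the leading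
  coefficient.\<close>

lemma circ_real_part_poly:
  assumes A: "degree A < 2 * n" "coeff A 0 = 1"
  obtains P :: "real poly" where "degree P = n" "lead_coeff P = 1"
    "\<And>x. x \<in> {-2..2} \<Longrightarrow> poly P x = 2 * Re (cnj (circ x) ^ n * circ_poly A x)"
proof -
  obtain C :: "nat \<Rightarrow> real poly" where C: "\<And>k. degree (C k) \<le> k" "\<And>k. k > 0 \<Longrightarrow> coeff (C k) k = 1"
    "\<And>k x. x \<in> {-2..2} \<Longrightarrow> poly (C k) x = 2 * Re (circ x ^ k)"
    using chebyshev_exists by metis
  have n: "n > 0" using A(1) by simp
  \<comment> \<open>The distance |i - n|: zeta^k and zeta^(-k) have the same real part.\<close>
  let ?d = "\<lambda>i. if i \<le> n then n - i else i - n"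
  let ?P = "\<Sum>i<2*n. Polynomial.smult (coeff A i) (C (?d i))"
  have "degree ?P \<le> n"
    by (rule degree_sum_le) (auto intro!: order.trans[OF degree_smult_le] order.trans[OF C(1)])
  moreover have c: "coeff ?P n = 1"
  proof -
    have "coeff ?P n = (\<Sum>i<2*n. if i = 0 then 1 else 0)"
      unfolding coeff_sum
    proof (rule sum.cong)
      fix i assume i: "i \<in> {..<2*n}"
      have "coeff (C (?d i)) n = 0" if "i \<noteq> 0"
        using that i n by (intro coeff_eq_0 le_less_trans[OF C(1)]) auto
      thus "coeff (Polynomial.smult (coeff A i) (C (?d i))) n = (if i = 0 then 1 else 0)"
        using A(2) C(2)[OF n] by auto
    qed simp
    thus ?thesis using n by simp
  qed
  ultimately have deg: "degree ?P = n" by (intro antisym le_degree) simp_all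
  have ev: "poly ?P x = 2 * Re (cnj (circ x) ^ n * circ_poly A x)" if x: "x \<in> {-2..2}" for x
  proof -
    have re: "Re (circ x ^ ?d i) = Re (cnj (circ x) ^ n * circ x ^ i)" for i
    proof (cases "i \<le> n")
      case True
      have "Re (circ x ^ (n - i)) = Re (cnj (circ x ^ n * cnj (circ x) ^ i))"
        unfolding circ_power_cancel[OF x True] by (simp only: cnj.sel)
      thus ?thesis using True by simp
    next
      case False
      thus ?thesis using circ_power_cancel[OF x, of n i] by (simp add: mult.commute)
    qed
    have "poly ?P x = (\<Sum>i<2*n. 2 * (coeff A i * Re (circ x ^ ?d i)))"
      using C(3)[OF x] by (simp add: poly_sum algebra_simps)
    also have "\<dots> = 2 * Re (cnj (circ x) ^ n * circ_poly A x)"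
    proof -
      have "cnj (circ x) ^ n * circ_poly A x =
          (\<Sum>i<2*n. complex_of_real (coeff A i) * (cnj (circ x) ^ n * circ x ^ i))"
        unfolding circ_poly_altdef[OF A(1)] by (simp only: sum_distrib_left mult.left_commute)
      hence "Re (cnj (circ x) ^ n * circ_poly A x) =
          (\<Sum>i<2*n. coeff A i * Re (cnj (circ x) ^ n * circ x ^ i))"
        by (simp only: Re_sum Re_complex_of_real_mult)
      thus ?thesis unfolding re by (simp only: sum_distrib_left)
    qed
    finally show ?thesis .
  qed
  show thesis by (rule that[OF deg _ ev]) (simp only: deg c)
qed

section \<open>Limits of minimal norms\<close>

text \<open>Convergence to E of the minimal squared norms, phrased without \<open>orthopoly\<close>
  because removing one mass point at a time leads through measures that are not even.\<close>

definition monic_norm_limit :: "real measure \<Rightarrow> real \<Rightarrow> bool" where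
  "monic_norm_limit M E \<longleftrightarrow> (\<forall>\<epsilon>>0. \<exists>N. \<forall>n\<ge>N.
     (\<forall>P. degree P = n \<and> lead_coeff P = 1 \<longrightarrow> E - \<epsilon> \<le> (\<integral>x. (poly P x)\<^sup>2 \<partial>M)) \<and>
     (\<exists>P. degree P = n \<and> lead_coeff P = 1 \<and> (\<integral>x. (poly P x)\<^sup>2 \<partial>M) \<le> E + \<epsilon>))"

lemma integrable_continuous_bounded_support:
  fixes f :: "real \<Rightarrow> real"
  assumes M: "finite_measure M" "sets M = sets borel" "AE x in M. \<bar>x\<bar> \<le> B"
    and f: "continuous_on UNIV f"
  shows "integrable M f"
proof -
  interpret finite_measure M by fact
  have "compact (f ` {-B..B})"
    by (rule compact_continuous_image) (auto intro: continuous_on_subset[OF f])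
  hence "bounded (f ` {-B..B})" by (rule compact_imp_bounded)
  then obtain C where C: "\<And>x. x \<in> {-B..B} \<Longrightarrow> norm (f x) \<le> C"
    unfolding bounded_iff by blast
  show ?thesis
  proof (rule integrable_const_bound)
    show "AE x in M. norm (f x) \<le> C" using M(3) by eventually_elim (rule C, auto)
    show "f \<in> borel_measurable M"
      unfolding measurable_cong_sets[OF M(2) refl] using f by (rule borel_measurable_continuous_onI)
  qed
qed

lemma degree_lead_coeff_diff_lower:
  fixes P :: "real poly"
  assumes "degree P = n" "lead_coeff P = 1" "degree Q < n"
  shows "degree (P - Q) = n" "lead_coeff (P - Q) = 1"
proof -
  show "degree (P - Q) = n" using degree_add_eq_left[of "- Q" P] assms by simp
  thus "lead_coeff (P - Q) = 1" using assms by (simp add: coeff_eq_0)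
qed

text \<open>A polynomial of bounded norm has bounded value at the atom y. Subtracting that value
  times a power of T, where T is 1 at y and at most q < 1 on the rest of the support, produces a
  zero at y at exponentially small cost, and the quotient by x - y competes for the weight (x -
  y)^2. Conversely, multiplication by x - y gives the upper bound.\<close>

lemma monic_norm_limit_mass_point:
  fixes \<mu> :: "real measure"
  assumes \<mu>: "finite_measure \<mu>" "sets \<mu> = sets borel" "AE x in \<mu>. \<bar>x\<bar> \<le> B"
    and isolated: "AE x in \<mu>. x = y \<or> d \<le> \<bar>x - y\<bar>" and d: "d > 0"
    and mass: "measure \<mu> {y} > 0"
    and lim: "monic_norm_limit (density \<mu> (\<lambda>x. ennreal ((x - y)\<^sup>2))) E" and E: "E > 0"
  shows "monic_norm_limit \<mu> E"
  unfolding monic_norm_limit_def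
proof (intro allI impI)
  interpret finite_measure \<mu> by fact
  note [measurable_cong] = \<mu>(2)
  have [simp]: "space \<mu> = UNIV" using sets_eq_imp_space_eq[OF \<mu>(2)] by simp
  note int = integrable_continuous_bounded_support[OF \<mu>]
  let ?M = "density \<mu> (\<lambda>x. ennreal ((x - y)\<^sup>2))"
  define c where "c = measure \<mu> {y}"
  define tot where "tot = measure \<mu> UNIV"
  \<comment> \<open>D bounds |x - y| on the support and is at least d, so T lies between 0 and q = 1
    - d^2 / D^2 away from y.\<close>
  define D where "D = \<bar>B\<bar> + \<bar>y\<bar> + d"
  define q where "q = 1 - d\<^sup>2 / D\<^sup>2"
  define T where "T = [:1:] - Polynomial.smult (1 / D\<^sup>2) ([:-y,1:]\<^sup>2)"
  have D: "D > 0" "d \<le> D" using d by (auto simp: D_def)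
  have q: "0 \<le> q" "q < 1" using D d by (auto simp: q_def divide_le_eq power_mono)
  have T: "poly T x = 1 - (x - y)\<^sup>2 / D\<^sup>2" for x by (simp add: T_def power2_eq_square diff_divide_distrib add_divide_distrib algebra_simps)
  have degT: "degree T \<le> 2"
    unfolding T_def by (intro degree_diff_le order.trans[OF degree_smult_le]) (auto simp: degree_power_eq)
  have Tq: "0 \<le> poly T x \<and> poly T x \<le> q" if "\<bar>x\<bar> \<le> B" "d \<le> \<bar>x - y\<bar>" for x
  proof -
    have "\<bar>x - y\<bar> \<le> D" using that d by (auto simp: D_def)
    hence "(x - y)\<^sup>2 \<le> D\<^sup>2" using D by (simp add: abs_le_square_iff[symmetric])
    moreover have "d\<^sup>2 \<le> (x - y)\<^sup>2" using that d by (simp add: abs_le_square_iff[symmetric])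
    ultimately show ?thesis using D by (simp add: T q_def divide_le_eq divide_right_mono)
  qed
  have factor: "(\<integral>x. (poly ([:-y,1:] * R) x)\<^sup>2 \<partial>\<mu>) = (\<integral>x. (poly R x)\<^sup>2 \<partial>?M)" for R
  proof -
    have "(poly ([:-y,1:] * R) x)\<^sup>2 = (x - y)\<^sup>2 *\<^sub>R (poly R x)\<^sup>2" for x
      by (simp add: power_mult_distrib[symmetric] algebra_simps)
    moreover have "(\<integral>x. (poly R x)\<^sup>2 \<partial>?M) = (\<integral>x. (x - y)\<^sup>2 *\<^sub>R (poly R x)\<^sup>2 \<partial>\<mu>)"
      by (rule integral_density) (auto intro!: borel_measurable_integrable int continuous_intros)
    ultimately show ?thesis by simp
  qed
  fix \<epsilon> :: real assume \<epsilon>: "\<epsilon> > 0"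
  \<comment> \<open>The error has three parts: from the limit for the weighted measure, from the
    factor 1 + \<delta>, and from the term with q^k. Here \<delta> * (E + 1) = \<epsilon> /
    3.\<close>
  define \<delta> where "\<delta> = \<epsilon> / (3 * (E + 1))"
  have \<delta>: "\<delta> > 0" using \<epsilon> E by (simp add: \<delta>_def)
  have "\<epsilon>/3 > 0" using \<epsilon> by simp
  then obtain N1 where "\<forall>n\<ge>N1.
     (\<forall>P. degree P = n \<and> lead_coeff P = 1 \<longrightarrow> E - \<epsilon>/3 \<le> (\<integral>x. (poly P x)\<^sup>2 \<partial>?M)) \<and>
     (\<exists>P. degree P = n \<and> lead_coeff P = 1 \<and> (\<integral>x. (poly P x)\<^sup>2 \<partial>?M) \<le> E + \<epsilon>/3)"
    using lim unfolding monic_norm_limit_def by blast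
  hence N1:
    "\<And>n P. n \<ge> N1 \<Longrightarrow> degree P = n \<Longrightarrow> lead_coeff P = 1 \<Longrightarrow> E - \<epsilon>/3 \<le> (\<integral>x. (poly P x)\<^sup>2 \<partial>?M)"
    "\<And>n. n \<ge> N1 \<Longrightarrow> \<exists>P. degree P = n \<and> lead_coeff P = 1 \<and> (\<integral>x. (poly P x)\<^sup>2 \<partial>?M) \<le> E + \<epsilon>/3"
    by blast+
  define K where "K = (1 + 1/\<delta>) * ((E + 1) / c) * tot"
  have "(\<lambda>k. K * (q ^ k)\<^sup>2) \<longlonglongrightarrow> K * 0\<^sup>2"
    using q by (intro tendsto_intros LIMSEQ_power_zero) auto
  hence "eventually (\<lambda>k. K * (q ^ k)\<^sup>2 < \<epsilon>/3) sequentially"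
    using \<epsilon> by (intro order_tendstoD) auto
  then obtain k0 where k0: "\<And>k. k \<ge> k0 \<Longrightarrow> K * (q ^ k)\<^sup>2 < \<epsilon>/3"
    by (auto simp: eventually_sequentially)
  show "\<exists>N. \<forall>n\<ge>N.
     (\<forall>P. degree P = n \<and> lead_coeff P = 1 \<longrightarrow> E - \<epsilon> \<le> (\<integral>x. (poly P x)\<^sup>2 \<partial>\<mu>)) \<and>
     (\<exists>P. degree P = n \<and> lead_coeff P = 1 \<and> (\<integral>x. (poly P x)\<^sup>2 \<partial>\<mu>) \<le> E + \<epsilon>)"
  \<comment> \<open>This gives n - 1 \<ge> N1 for the quotient by x - y, and (n - 1) div 2 \<ge> k0
    for the power of the quadratic T.\<close>
  proof (intro exI[of _ "N1 + 2 * k0 + 2"] allI impI conjI)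
    fix n assume n: "n \<ge> N1 + 2 * k0 + 2"
    obtain R where R: "degree R = n - 1" "lead_coeff R = 1" "(\<integral>x. (poly R x)\<^sup>2 \<partial>?M) \<le> E + \<epsilon>/3"
    proof -
      have "N1 \<le> n - 1" using n by simp
      from N1(2)[OF this] that show thesis by blast
    qed
    have "R \<noteq> 0" using R(2) by auto
    hence "degree ([:-y,1:] * R) = n" using R(1) n by (subst degree_mult_eq) auto
    moreover have "lead_coeff ([:-y,1:] * R) = 1" using R(2) by (subst lead_coeff_mult) auto
    moreover have "(\<integral>x. (poly ([:-y,1:] * R) x)\<^sup>2 \<partial>\<mu>) \<le> E + \<epsilon>" using R(3) \<epsilon> unfolding factor by simp
    ultimately show "\<exists>P. degree P = n \<and> lead_coeff P = 1 \<and> (\<integral>x. (poly P x)\<^sup>2 \<partial>\<mu>) \<le> E + \<epsilon>" by blast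
  next
    fix n :: nat and P :: "real poly" assume n: "n \<ge> N1 + 2 * k0 + 2" and P: "degree P = n \<and> lead_coeff P = 1"
    define I where "I = (\<integral>x. (poly P x)\<^sup>2 \<partial>\<mu>)"
    have intP: "integrable \<mu> (\<lambda>x. (poly P x)\<^sup>2)" by (intro int continuous_intros)
    show "E - \<epsilon> \<le> (\<integral>x. (poly P x)\<^sup>2 \<partial>\<mu>)"
    proof (cases "I \<le> E + 1")
      case False
      thus ?thesis using \<epsilon> by (simp add: I_def)
    next
      case True
      have "(\<integral>x. (poly P y)\<^sup>2 * indicator {y} x \<partial>\<mu>) \<le> I"
        unfolding I_def by (intro integral_mono' intP) (auto simp: indicator_def)
      hence "(poly P y)\<^sup>2 * c \<le> I" by (simp add: c_def)
      hence Py: "(poly P y)\<^sup>2 \<le> (E + 1) / c" using True mass by (simp add: c_def field_simps)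
      define k where "k = (n - 1) div 2"
      define S where "S = P - Polynomial.smult (poly P y) (T ^ k)"
      have "degree (Polynomial.smult (poly P y) (T ^ k)) \<le> 2 * k"
        by (intro order.trans[OF degree_smult_le] order.trans[OF degree_power_le] mult_le_mono) (use degT in auto)
      also have "\<dots> < n" using n by (auto simp: k_def)
      finally have S: "degree S = n" "lead_coeff S = 1"
        using degree_lead_coeff_diff_lower P unfolding S_def by blast+
      have "poly S y = 0" by (simp add: S_def T)
      then obtain R where R: "S = [:-y,1:] * R" by (auto simp: poly_eq_0_iff_dvd elim: dvdE)
      have "R \<noteq> 0" using S(2) R by auto
      hence "degree R = n - 1" using S(1) unfolding R by (subst (asm) degree_mult_eq) auto
      moreover have "lead_coeff R = 1" using S(2) unfolding R by (subst (asm) lead_coeff_mult) auto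
      ultimately have "E - \<epsilon>/3 \<le> (\<integral>x. (poly S x)\<^sup>2 \<partial>\<mu>)"
        unfolding R factor using N1(1)[of "n - 1" R] n by auto
      also have "\<dots> \<le> (\<integral>x. (1 + \<delta>) * (poly P x)\<^sup>2 + (1 + 1/\<delta>) * ((E + 1) / c) * (q ^ k)\<^sup>2 \<partial>\<mu>)"
      proof (rule integral_mono_AE)
        show "integrable \<mu> (\<lambda>x. (poly S x)\<^sup>2)" by (intro int continuous_intros)
        show "integrable \<mu> (\<lambda>x. (1 + \<delta>) * (poly P x)\<^sup>2 + (1 + 1/\<delta>) * ((E + 1) / c) * (q ^ k)\<^sup>2)"
          by (intro int continuous_intros)
        show "AE x in \<mu>. (poly S x)\<^sup>2 \<le> (1 + \<delta>) * (poly P x)\<^sup>2 + (1 + 1/\<delta>) * ((E + 1) / c) * (q ^ k)\<^sup>2"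
          using isolated \<mu>(3)
        proof eventually_elim
          case (elim x)
          show ?case
          proof (cases "x = y")
            case True
            thus ?thesis using \<open>poly S y = 0\<close> \<delta> E mass by (simp add: c_def)
          next
            case False
            define b where "b = poly P y * poly T x ^ k"
            have "(poly T x ^ k)\<^sup>2 \<le> (q ^ k)\<^sup>2"
              using Tq[of x] elim False by (intro power_mono) auto
            hence b: "b\<^sup>2 \<le> (E + 1) / c * (q ^ k)\<^sup>2"
              unfolding b_def power_mult_distrib by (intro mult_mono Py) (use E mass in \<open>auto simp: c_def\<close>)
            \<comment> \<open>The weighted triangle inequality (p - b)^2 \<le> (1 + \<delta>) p^2 +
              (1 + 1/\<delta>) b^2, as a completed square.\<close>
            have "0 \<le> (\<delta> * poly P x + b)\<^sup>2 / \<delta>" using \<delta> by simp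
            also have "\<dots> = (1 + \<delta>) * (poly P x)\<^sup>2 + (1 + 1/\<delta>) * b\<^sup>2 - (poly P x - b)\<^sup>2"
              using \<delta> by (simp add: field_simps power2_eq_square)
            finally have "(poly S x)\<^sup>2 \<le> (1 + \<delta>) * (poly P x)\<^sup>2 + (1 + 1/\<delta>) * b\<^sup>2"
              by (simp add: S_def b_def)
            also have "(1 + 1/\<delta>) * b\<^sup>2 \<le> (1 + 1/\<delta>) * ((E + 1) / c * (q ^ k)\<^sup>2)"
              using b \<delta> by (intro mult_left_mono) auto
            finally show ?thesis by (simp only: mult.assoc)
          qed
        qed
      qed
      also have "\<dots> = (1 + \<delta>) * I + K * (q ^ k)\<^sup>2"
        using intP by (simp add: I_def K_def tot_def)
      finally have "E - \<epsilon>/3 \<le> I + \<delta> * I + K * (q ^ k)\<^sup>2" by (simp add: algebra_simps)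
      moreover have "\<delta> * I \<le> \<delta> * (E + 1)" using True \<delta> by (intro mult_left_mono) auto
      moreover have "\<delta> * (E + 1) = \<epsilon> / 3"
      proof -
        have "E + 1 \<noteq> 0" using E by simp
        thus ?thesis
          unfolding \<delta>_def times_divide_eq_left by (rule nonzero_mult_divide_mult_cancel_right)
      qed
      moreover have "K * (q ^ k)\<^sup>2 < \<epsilon>/3" using n by (intro k0) (simp add: k_def)
      ultimately show ?thesis by (simp add: I_def)
    qed
  qed
qed

text \<open>Source of the factor 2 between the two extremal values: for u = zeta^(-n) A(zeta) the
  first term gives twice the circle norm, and the second turns out to be negligible.\<close>

lemma Re_square_double: "(2 * Re u)\<^sup>2 = 2 * (cmod u)\<^sup>2 + 2 * Re (u\<^sup>2)"
  unfolding cmod_power2 by (simp add: power2_eq_square algebra_simps)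

text \<open>For a real polynomial \<open>A\<close> of degree less than \<open>2n\<close> with \<open>A(0) = 1\<close>, on the circle \<open>2 Re (\<zeta>\<^sup>-\<^sup>n A(\<zeta>))\<close> is a monic
  polynomial of degree \<open>n\<close> in \<open>x = \<zeta> + 1/\<zeta>\<close>. If \<open>A\<close> almost minimises the norm among the polynomials with
  \<open>A(0) = 1\<close>, it is almost orthogonal to all polynomials vanishing at 0, so that this polynomial almost
  minimises the norm on the interval.\<close>

theorem monic_norm_limit_interval:
  assumes M: "finite_measure M" "sets M = sets borel" "AE x in M. x \<in> {-2..2}"
    and c: "c > 0" "\<And>Q. coeff Q 0 = 1 \<Longrightarrow> c \<le> (\<integral>x. (cmod (circ_poly Q x))\<^sup>2 \<partial>M)"
  shows "\<exists>E>0. monic_norm_limit M E"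
proof -
  have "AE x in M. \<bar>x\<bar> \<le> 2" using M(3) by eventually_elim auto
  note int = integrable_continuous_bounded_support[OF M(1,2) this]
  define N where "N Q = (\<integral>x. (cmod (circ_poly Q x))\<^sup>2 \<partial>M)" for Q
  define J where "J Q R = (\<integral>x. Re (circ_poly Q x * cnj (circ_poly R x)) \<partial>M)" for Q R
  have int': "integrable M (\<lambda>x. (cmod (circ_poly Q x))\<^sup>2)"
    "integrable M (\<lambda>x. Re (circ_poly Q x * cnj (circ_poly R x)))" "integrable M (\<lambda>x. (poly P x)\<^sup>2)" for Q R P
    by (intro int continuous_intros)+
  define m where "m = Inf (N ` {Q. coeff Q 0 = 1})"
  have ne: "N ` {Q. coeff Q 0 = 1} \<noteq> {}" by (auto intro!: exI[of _ 1])
  have bdd: "bdd_below (N ` {Q. coeff Q 0 = 1})" using c(2) by (auto simp: N_def intro!: bdd_belowI[of _ c])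
  have m_le: "m \<le> N Q" if "coeff Q 0 = 1" for Q
    unfolding m_def using that bdd by (intro cInf_lower) auto
  have "c \<le> m" unfolding m_def using c(2) ne by (intro cInf_greatest) (auto simp: N_def)
  hence m: "m > 0" using c(1) by simp
  have N_add: "N (A + Polynomial.smult t R) = N A + 2 * t * J A R + t\<^sup>2 * N R" for A R t
  proof -
    have "(cmod (circ_poly (A + Polynomial.smult t R) x))\<^sup>2 = (cmod (circ_poly A x))\<^sup>2 +
        (2 * t * Re (circ_poly A x * cnj (circ_poly R x)) + t\<^sup>2 * (cmod (circ_poly R x))\<^sup>2)" for x
      unfolding cmod_power2 by (simp add: power2_eq_square algebra_simps)
    hence "N (A + Polynomial.smult t R) = (\<integral>x. (cmod (circ_poly A x))\<^sup>2 +
        (2 * t * Re (circ_poly A x * cnj (circ_poly R x)) + t\<^sup>2 * (cmod (circ_poly R x))\<^sup>2) \<partial>M)"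
      unfolding N_def by simp
    also have "\<dots> = N A + (2 * t * J A R + t\<^sup>2 * N R)"
      unfolding N_def J_def
      using int' by (simp del: times_complex.sel)
    finally show ?thesis by simp
  qed
  \<comment> \<open>Variations with R(0) = 0 keep the value 1 at 0, so this quadratic in t stays
    above m; if \<open>N A\<close> is close to m, then \<open>J A R\<close> is forced to be small
    relative to \<open>N R\<close>.\<close>
  have J_bound: "m \<le> N A + 2 * t * J A R + t\<^sup>2 * N R" if "coeff A 0 = 1" "coeff R 0 = 0" for A R t
    using m_le[of "A + Polynomial.smult t R"] that by (simp add: N_add)
  show ?thesis
  proof (intro exI[of _ "2 * m"] conjI)
    show "2 * m > 0" using m by simp
    show "monic_norm_limit M (2 * m)"
      unfolding monic_norm_limit_def
    proof (intro allI impI)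
      fix \<epsilon> :: real assume \<epsilon>: "\<epsilon> > 0"
      \<comment> \<open>The errors add up to at most
        \<open>\<delta> * (m + 2) + 4 * \<delta>\<^sup>2\<close>, which is at most \<delta> * (m +
        6) as \<delta> \<le> 1.\<close>
      define \<delta> where "\<delta> = min 1 (\<epsilon> / (6 + m))"
      have \<delta>: "0 < \<delta>" "\<delta> \<le> 1" "\<delta> \<le> \<epsilon> / (6 + m)" using \<epsilon> m by (auto simp: \<delta>_def)
      have \<delta>': "\<delta> * (6 + m) \<le> \<epsilon>" using \<delta>(3) m by (simp add: pos_le_divide_eq)
      have "\<delta>\<^sup>2 \<le> \<delta>" using \<delta> by (simp add: power2_eq_square mult_left_le)
      note \<delta> = \<delta>(1,2) \<delta>' this
      have "\<exists>v\<in>N ` {Q. coeff Q 0 = 1}. v < m + \<delta>\<^sup>2"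
        unfolding m_def using \<delta>(1) cInf_lessD[OF ne, of "m + \<delta>\<^sup>2"] by (auto simp: m_def)
      \<comment> \<open>Closeness of order \<open>\<delta>\<^sup>2\<close> is asked for because
        \<open>J_bound\<close> at t = \<delta> is divided by \<delta> below.\<close>
      then obtain A where A: "coeff A 0 = 1" "N A < m + \<delta>\<^sup>2" by auto
      show "\<exists>N. \<forall>n\<ge>N.
        (\<forall>P. degree P = n \<and> lead_coeff P = 1 \<longrightarrow> 2 * m - \<epsilon> \<le> (\<integral>x. (poly P x)\<^sup>2 \<partial>M)) \<and>
        (\<exists>P. degree P = n \<and> lead_coeff P = 1 \<and> (\<integral>x. (poly P x)\<^sup>2 \<partial>M) \<le> 2 * m + \<epsilon>)"
      proof (rule exI[of _ "degree A + 1"], rule allI, rule impI)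
        fix n assume n: "degree A + 1 \<le> n"
        hence dA: "degree A < 2 * n" by simp
        obtain P0 :: "real poly" where P0: "degree P0 = n" "lead_coeff P0 = 1"
          "\<And>x. x \<in> {-2..2} \<Longrightarrow> poly P0 x = 2 * Re (cnj (circ x) ^ n * circ_poly A x)"
          using circ_real_part_poly[OF dA A(1)] by blast
        \<comment> \<open>For u = zeta^(-n) A the square of u is A times the conjugate of B. As B(0)
          = 0, B is an admissible variation and \<open>J A B\<close> is small.\<close>
        obtain B where B: "coeff B 0 = 0"
          "\<And>x. x \<in> {-2..2} \<Longrightarrow> circ x ^ (2 * n) * cnj (circ_poly A x) = circ_poly B x"
          using circ_poly_reverse[OF dA] by blast
        have NB: "N B = N A"
          unfolding N_def
        proof (rule integral_cong_AE)
          show "AE x in M. (cmod (circ_poly B x))\<^sup>2 = (cmod (circ_poly A x))\<^sup>2"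
            using M(3)
          proof eventually_elim
            case (elim x)
            thus ?case using norm_circ[OF elim] by (simp add: B(2)[OF elim, symmetric] norm_mult norm_power)
          qed
        qed (auto intro!: borel_measurable_integrable int continuous_intros)
        have intP0: "(\<integral>x. (poly P0 x)\<^sup>2 \<partial>M) = 2 * N A + 2 * J A B"
        proof -
          have "(\<integral>x. (poly P0 x)\<^sup>2 \<partial>M) =
              (\<integral>x. 2 * (cmod (circ_poly A x))\<^sup>2 + 2 * Re (circ_poly A x * cnj (circ_poly B x)) \<partial>M)"
          proof (rule integral_cong_AE)
            show "AE x in M. (poly P0 x)\<^sup>2 =
                2 * (cmod (circ_poly A x))\<^sup>2 + 2 * Re (circ_poly A x * cnj (circ_poly B x))"
              using M(3)
            proof eventually_elim
              case (elim x)
              have "(cnj (circ x) ^ n * circ_poly A x)\<^sup>2 = circ_poly A x * cnj (circ_poly B x)"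
                by (simp add: B(2)[OF elim, symmetric] power_mult_distrib power2_eq_square power_mult algebra_simps)
              thus ?case unfolding P0(3)[OF elim] Re_square_double
                using norm_circ[OF elim] by (simp add: norm_mult norm_power)
            qed
          qed (auto intro!: borel_measurable_integrable int continuous_intros)
          also have "\<dots> = 2 * N A + 2 * J A B"
            unfolding N_def J_def
            using int' by (simp del: times_complex.sel)
          finally show ?thesis .
        qed
        have "2 * \<delta> * \<bar>J A B\<bar> \<le> N A - m + \<delta>\<^sup>2 * N A"
          using J_bound[OF A(1) B(1), of \<delta>] J_bound[OF A(1) B(1), of "-\<delta>"] NB
          by (cases "J A B \<ge> 0") auto
        also have "\<dots> \<le> \<delta>\<^sup>2 + \<delta>\<^sup>2 * (m + 1)"
          using A(2) \<delta> by (intro add_mono mult_left_mono) auto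
        also have "\<dots> = \<delta> * (\<delta> * (m + 2))" by (simp add: power2_eq_square algebra_simps)
        finally have JAB: "2 * \<bar>J A B\<bar> \<le> \<delta> * (m + 2)" using \<delta>(1) by simp
        have lower: "2 * m - \<epsilon> \<le> (\<integral>x. (poly P x)\<^sup>2 \<partial>M)" if P: "degree P = n" "lead_coeff P = 1" for P
        proof -
          define S where "S = P - P0"
          have "degree S < n"
          proof (rule degree_lessI)
            show "S \<noteq> 0 \<or> 0 < n" using n by simp
            show "\<forall>k\<ge>n. coeff S k = 0"
            proof (intro allI impI)
              fix k assume "n \<le> k"
              thus "coeff S k = 0" using P P0(1,2) by (cases "k = n") (auto simp: S_def coeff_eq_0)
            qed
          qed
          then obtain R where R: "coeff R 0 = 0"
            "\<And>x. x \<in> {-2..2} \<Longrightarrow> circ x ^ n * complex_of_real (poly S x) = circ_poly R x"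
            using circ_power_mult_poly by blast
          have "(\<integral>x. (poly P x)\<^sup>2 \<partial>M) = (\<integral>x. (poly P0 x)\<^sup>2 +
              (4 * Re (circ_poly A x * cnj (circ_poly R x)) + (cmod (circ_poly R x))\<^sup>2) \<partial>M)"
          proof (rule integral_cong_AE)
            show "AE x in M. (poly P x)\<^sup>2 = (poly P0 x)\<^sup>2 +
              (4 * Re (circ_poly A x * cnj (circ_poly R x)) + (cmod (circ_poly R x))\<^sup>2)"
              using M(3)
            proof eventually_elim
              case (elim x)
              have "circ_poly A x * cnj (circ_poly R x) =
                  (cnj (circ x) ^ n * circ_poly A x) * complex_of_real (poly S x)"
                by (simp add: R(2)[OF elim, symmetric] algebra_simps)
              hence "4 * Re (circ_poly A x * cnj (circ_poly R x)) = 2 * poly P0 x * poly S x"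
                unfolding P0(3)[OF elim] by (simp only: Re_mult_real)
              moreover have "(cmod (circ_poly R x))\<^sup>2 = (poly S x)\<^sup>2"
                using norm_circ[OF elim] by (simp add: R(2)[OF elim, symmetric] norm_mult norm_power)
              moreover have "poly P x = poly P0 x + poly S x" by (simp add: S_def)
              ultimately show ?case by (simp add: power2_eq_square algebra_simps)
            qed
          qed (auto intro!: borel_measurable_integrable int continuous_intros)
          also have "\<dots> = (\<integral>x. (poly P0 x)\<^sup>2 \<partial>M) + (4 * J A R + N R)"
            unfolding N_def J_def
            using int' by (simp del: times_complex.sel)
          finally have "(\<integral>x. (poly P x)\<^sup>2 \<partial>M) = 2 * N A + 2 * J A B + (4 * J A R + N R)"
            unfolding intP0 .
          \<comment> \<open>The polynomial A + R / 2 is admissible, and t = 1/2 produces the weights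
            4 and 1 of \<open>J A R\<close> and \<open>N R\<close>.\<close>
          moreover have "4 * m \<le> 4 * N A + 4 * J A R + N R"
            using J_bound[OF A(1) R(1), of "1/2"] by (simp add: power2_eq_square)
          ultimately have "2 * m - \<delta> * (m + 2) - 4 * \<delta>\<^sup>2 \<le> (\<integral>x. (poly P x)\<^sup>2 \<partial>M)"
            using JAB A(2) m_le[OF A(1)] by linarith
          moreover have "\<delta> * (m + 2) + 4 * \<delta>\<^sup>2 \<le> \<epsilon>"
            using \<delta> by (simp add: algebra_simps)
          ultimately show ?thesis by linarith
        qed
        have "(\<integral>x. (poly P0 x)\<^sup>2 \<partial>M) \<le> 2 * m + 2 * \<delta>\<^sup>2 + \<delta> * (m + 2)"
          unfolding intP0 using JAB A(2) by linarith
        also have "\<dots> \<le> 2 * m + \<epsilon>" using \<delta> by (simp add: algebra_simps)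
        finally show "(\<forall>P. degree P = n \<and> lead_coeff P = 1 \<longrightarrow> 2 * m - \<epsilon> \<le> (\<integral>x. (poly P x)\<^sup>2 \<partial>M)) \<and>
          (\<exists>P. degree P = n \<and> lead_coeff P = 1 \<and> (\<integral>x. (poly P x)\<^sup>2 \<partial>M) \<le> 2 * m + \<epsilon>)"
          using lower P0(1,2) by blast
      qed
    qed
  qed
qed

section \<open>The Szego condition\<close>

text \<open>The half [pi, 2 pi] is chosen because 2 cos t increases there, as the substitution rule
  requires.\<close>

lemma nn_integral_cos_substitution:
  fixes f :: "real \<Rightarrow> ennreal"
  assumes "f \<in> borel_measurable borel"
  shows "(\<integral>\<^sup>+x. f x * indicator {-2..2} x \<partial>lborel) =
    (\<integral>\<^sup>+t. f (2 * cos t) * ennreal (- 2 * sin t) * indicator {pi..2 * pi} t \<partial>lborel)"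
proof -
  have "- 2 * sin t \<ge> 0" if "t \<in> {pi..2 * pi}" for t
    using that sin_ge_zero[of "t - pi"] by simp
  moreover have "((\<lambda>t. 2 * cos t) has_real_derivative - 2 * sin t) (at t)" for t
    by (auto intro!: derivative_eq_intros)
  moreover have "continuous_on {pi..2 * pi} (\<lambda>t. - 2 * sin t)" by (intro continuous_intros)
  ultimately show ?thesis
    using nn_integral_substitution_aux[of f pi "2 * pi" "\<lambda>t. 2 * cos t" "\<lambda>t. - 2 * sin t"] assms
    by simp
qed

lemma nn_integral_circle_symmetric:
  fixes f :: "real \<Rightarrow> ennreal"
  assumes f [measurable]: "f \<in> borel_measurable borel" and sym: "\<And>t. f (2 * pi - t) = f t"
  shows "(\<integral>\<^sup>+t. f t \<partial>circle_measure) = 2 * (\<integral>\<^sup>+t. f t * indicator {pi..2 * pi} t \<partial>lborel)"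
proof -
  have "(\<integral>\<^sup>+t. f t * indicator {pi..2 * pi} t \<partial>lborel) =
      (\<integral>\<^sup>+t. f (2 * pi + (-1) * t) * indicator {pi..2 * pi} (2 * pi + (-1) * t) \<partial>lborel)"
    by (subst nn_integral_real_affine[where c = "-1" and t = "2 * pi"]) auto
  also have "\<dots> = (\<integral>\<^sup>+t. f t * indicator {0..pi} t \<partial>lborel)"
    using sym by (intro nn_integral_cong) (auto simp: indicator_def)
  finally have eq: "(\<integral>\<^sup>+t. f t * indicator {pi..2 * pi} t \<partial>lborel) = (\<integral>\<^sup>+t. f t * indicator {0..pi} t \<partial>lborel)" .
  have "(\<integral>\<^sup>+t. f t \<partial>circle_measure) = (\<integral>\<^sup>+t. f t * indicator {0..2 * pi} t \<partial>lborel)"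
    by (simp add: nn_integral_restrict_space)
  also have "\<dots> = (\<integral>\<^sup>+t. f t * indicator {0..pi} t + f t * indicator {pi..2 * pi} t \<partial>lborel)"
    by (rule nn_integral_cong_AE, use AE_lborel_singleton[of pi] in eventually_elim)
       (auto simp: indicator_def)
  also have "\<dots> = (\<integral>\<^sup>+t. f t * indicator {0..pi} t \<partial>lborel) + (\<integral>\<^sup>+t. f t * indicator {pi..2 * pi} t \<partial>lborel)"
    by (rule nn_integral_add) measurable
  also have "\<dots> = 2 * (\<integral>\<^sup>+t. f t * indicator {pi..2 * pi} t \<partial>lborel)"
    unfolding eq by (rule mult_2[symmetric])
  finally show ?thesis .
qed

lemma sin_neq_0_AE: "AE t in lborel. t \<in> {0..2 * pi} \<longrightarrow> sin t \<noteq> 0"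
  using AE_lborel_singleton[of 0] AE_lborel_singleton[of pi] AE_lborel_singleton[of "2 * pi"]
proof eventually_elim
  case (elim t)
  show ?case
  proof (rule impI)
    assume t: "t \<in> {0..2 * pi}"
    show "sin t \<noteq> 0"
    proof (cases "t < pi")
      case True
      thus ?thesis using sin_gt_zero[of t] t elim by auto
    next
      case False
      thus ?thesis using sin_gt_zero[of "t - pi"] t elim by auto
    qed
  qed
qed

lemma norm_one_minus_cis_square: "cmod (1 - cis t ^ 2) = 2 * \<bar>sin t\<bar>"
proof -
  have "1 - cis t ^ 2 = cis t * (cis (-t) - cis t)"
    by (simp add: algebra_simps power2_eq_square cis_mult)
  also have "cis (-t) - cis t = complex_of_real (- 2 * sin t) * \<i>" by (simp add: complex_eq_iff)
  finally show ?thesis by (simp add: norm_mult)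
qed

text \<open>As 2 |sin t| = |1 - z| |1 + z| for z = cis t, this is a limit of the mean zero
  logarithms with b = r and b = -r. The approximants \<open>f n\<close> are nonnegative with
  constant integral 2 pi ln 2, and Fatou's lemma passes to r = 1.\<close>

lemma nn_integral_neg_ln_sin:
  "(\<integral>\<^sup>+t. ennreal (- ln \<bar>sin t\<bar>) \<partial>circle_measure) < \<infinity>"
proof -
  interpret finite_measure circle_measure by (rule finite_circle_measure)
  define r where "r n = 1 - 1 / (real n + 1)" for n :: nat
  have r: "r \<longlonglongrightarrow> 1" unfolding r_def by real_asymp
  have r01: "0 \<le> r n" "r n < 1" for n unfolding r_def by (auto simp: field_simps)
  define b where "b n = complex_of_real (r n)" for n
  have b: "cmod (b n) < 1" "cmod (- b n) < 1" for n using r01 by (auto simp: b_def)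
  let ?l = "\<lambda>b t. ln (cmod (1 - b * cis t))"
  define f where "f n t = ln 2 - (?l (b n) t + ?l (- b n) t)" for n t
  have f: "f n t = ln 2 - ln (cmod (1 - (b n * cis t)\<^sup>2))" for n t
  proof -
    have "1 - (b n * cis t)\<^sup>2 = (1 - b n * cis t) * (1 - (- b n) * cis t)"
      by (simp add: power2_eq_square algebra_simps)
    thus ?thesis using norm_one_minus_cis_pos[OF b(1), of n t] norm_one_minus_cis_pos[OF b(2), of n t]
      unfolding f_def by (simp only: norm_mult ln_mult_pos)
  qed
  have int: "integrable circle_measure (?l b)" if "cmod b < 1" for b
    using norm_one_minus_cis_pos[OF that]
    by (intro integrable_circle_measure continuous_intros) (auto simp: less_imp_neq[symmetric])
  have intf: "integrable circle_measure (f n)" for n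
    unfolding f_def by (intro Bochner_Integration.integrable_diff Bochner_Integration.integrable_add int b) simp
  have f0: "f n t \<ge> 0" for n t
  proof -
    have "cmod ((b n * cis t)\<^sup>2) \<le> 1" using b(1)[of n] by (simp add: norm_mult norm_power power_le_one)
    hence "cmod (1 - (b n * cis t)\<^sup>2) \<le> 2" using norm_triangle_ineq4[of 1 "(b n * cis t)\<^sup>2"] by simp
    moreover have "cmod (1 - (b n * cis t)\<^sup>2) > 0"
    proof -
      have "cmod ((b n * cis t)\<^sup>2) < 1" using b(1)[of n] by (simp add: norm_mult norm_power power_less_one_iff)
      hence "(b n * cis t)\<^sup>2 \<noteq> 1" by auto
      thus ?thesis by simp
    qed
    ultimately show ?thesis unfolding f by (simp add: ln_mono)
  qed
  have "(\<integral>\<^sup>+t. ennreal (f n t) \<partial>circle_measure) = ennreal (2 * pi * ln 2)" for n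
  proof -
    have "(\<integral>t. f n t \<partial>circle_measure) = 2 * pi * ln 2"
      unfolding f_def using int[OF b(1), of n] int[OF b(2), of n] measure_circle_measure
        integral_ln_norm_one_minus_cis[OF b(1), of n] integral_ln_norm_one_minus_cis[OF b(2), of n]
      by (subst Bochner_Integration.integral_diff) (simp_all add: lebesgue_integral_const)
    thus ?thesis using f0 by (subst nn_integral_eq_integral[OF intf]) auto
  qed
  hence lim: "(\<integral>\<^sup>+t. liminf (\<lambda>n. ennreal (f n t)) \<partial>circle_measure) \<le> ennreal (2 * pi * ln 2)"
    using nn_integral_liminf[of "\<lambda>n t. ennreal (f n t)" circle_measure] intf by (simp add: Liminf_const)
  have "(\<integral>\<^sup>+t. ennreal (- ln \<bar>sin t\<bar>) \<partial>circle_measure) \<le> (\<integral>\<^sup>+t. liminf (\<lambda>n. ennreal (f n t)) \<partial>circle_measure)"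
  proof (rule nn_integral_mono_AE)
    have "AE t in circle_measure. sin t \<noteq> 0"
      using sin_neq_0_AE by (subst AE_restrict_space_iff) auto
    thus "AE t in circle_measure. ennreal (- ln \<bar>sin t\<bar>) \<le> liminf (\<lambda>n. ennreal (f n t))"
    proof eventually_elim
      case (elim t)
      have "(\<lambda>n. ln 2 - ln (cmod (1 - (b n * cis t)\<^sup>2))) \<longlonglongrightarrow> ln 2 - ln (cmod (1 - (complex_of_real 1 * cis t)\<^sup>2))"
        unfolding b_def
        by (intro tendsto_intros r) (use norm_one_minus_cis_square[of t] elim in auto)
      also have "ln 2 - ln (cmod (1 - (complex_of_real 1 * cis t)\<^sup>2)) = - ln \<bar>sin t\<bar>"
        using elim by (simp add: norm_one_minus_cis_square ln_mult)
      finally have "(\<lambda>n. ennreal (f n t)) \<longlonglongrightarrow> ennreal (- ln \<bar>sin t\<bar>)"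
        unfolding f by (rule tendsto_ennrealI)
      from lim_imp_Liminf[OF trivial_limit_sequentially this] show ?case by simp
    qed
  qed
  also note lim
  finally show ?thesis by (simp add: le_less_trans)
qed

lemma borel_measurable_ereal_ln [measurable]: "ereal_ln \<in> borel_measurable borel"
  unfolding ereal_ln_def by measurable

text \<open>x = 2 cos t turns dx / sqrt (4 - x^2) into dt. The Szego condition bounds the negative
  part only once the positive part is known to be finite, because infinity minus infinity is
  infinity in \<open>ereal\<close>.\<close>

lemma szego_imp_log_integrable:
  assumes w [measurable]: "w \<in> borel_measurable borel" and w0: "\<And>x. 0 \<le> w x"
    and fin: "(\<integral>\<^sup>+x. ennreal (w x) * indicator {-2..2} x \<partial>lborel) < \<infinity>"
    and szego: "szego_condition w"
  shows "(\<integral>\<^sup>+t. (if 0 < w (2 * cos t) then ennreal (- ln (w (2 * cos t))) else \<infinity>) * indicator {pi..2*pi} t \<partial>lborel) < \<infinity>"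
proof -
  let ?h = "\<lambda>x. ereal_ln (w x) / ereal (sqrt (4 - x\<^sup>2))"
  let ?I = "\<lambda>f. \<integral>\<^sup>+x. f x * indicator {-2..2} x \<partial>lborel"
  have sqrt_eq: "sqrt (4 - (2 * cos t)\<^sup>2) = - 2 * sin t" if "t \<in> {pi..2 * pi}" for t
  proof -
    have "- 2 * sin t \<ge> 0" using that sin_ge_zero[of "t - pi"] by simp
    moreover have "4 - (2 * cos t)\<^sup>2 = (- 2 * sin t)\<^sup>2"
      by (simp add: power_mult_distrib cos_squared_eq)
    ultimately show ?thesis by (metis real_sqrt_unique)
  qed
  have spos: "- 2 * sin t > 0" if "t \<in> {pi..2 * pi}" "sin t \<noteq> 0" for t
    using that sin_ge_zero[of "t - pi"] by auto
  have AE: "AE t in lborel. t \<in> {pi..2 * pi} \<longrightarrow> sin t \<noteq> 0"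
    using sin_neq_0_AE by eventually_elim auto
  have "?I (\<lambda>x. e2ennreal (?h x)) =
    (\<integral>\<^sup>+t. e2ennreal (?h (2 * cos t)) * ennreal (- 2 * sin t) * indicator {pi..2 * pi} t \<partial>lborel)"
    by (rule nn_integral_cos_substitution) measurable
  also have "\<dots> \<le> (\<integral>\<^sup>+t. ennreal (w (2 * cos t)) * ennreal (- 2 * sin t) * indicator {pi..2 * pi} t +
      ennreal (- ln \<bar>sin t\<bar>) * indicator {0..2 * pi} t \<partial>lborel)"
  proof (rule nn_integral_mono_AE, use AE in eventually_elim)
    case (elim t)
    show ?case
    proof (cases "t \<in> {pi..2 * pi}")
      case True
      note s = spos[OF True elim[rule_format, OF True]]
      show ?thesis
      proof (cases "0 < w (2 * cos t)")
        case w: True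
        have "e2ennreal (?h (2 * cos t)) * ennreal (- 2 * sin t) = ennreal (ln (w (2 * cos t)))"
          using w s unfolding sqrt_eq[OF True]
          by (simp add: ereal_ln_def flip: ennreal_mult'')
        \<comment> \<open>ln y \<le> y - 1 is applied to y = w * (-2 sin t), the density in the
          variable t, whose integral is finite; the price -ln |sin t| is integrable by
          \<open>nn_integral_neg_ln_sin\<close>.\<close>
        also have "\<dots> \<le> ennreal (w (2 * cos t) * (- 2 * sin t) + (- ln \<bar>sin t\<bar>))"
        proof (rule ennreal_leI)
          have "ln (w (2 * cos t) * (- 2 * sin t)) \<le> w (2 * cos t) * (- 2 * sin t) - 1"
            by (rule ln_le_minus_one[OF mult_pos_pos[OF w s]])
          moreover have "ln (w (2 * cos t) * (- 2 * sin t)) = ln (w (2 * cos t)) + (ln 2 + ln \<bar>sin t\<bar>)"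
            using w s ln_mult_pos[OF w s] ln_mult_pos[of 2 "- sin t"] by simp
          moreover have "ln (2::real) \<ge> 0" by simp
          ultimately show "ln (w (2 * cos t)) \<le> w (2 * cos t) * (- 2 * sin t) + (- ln \<bar>sin t\<bar>)" by linarith
        qed
        also have "\<dots> = ennreal (w (2 * cos t)) * ennreal (- 2 * sin t) + ennreal (- ln \<bar>sin t\<bar>)"
        proof -
          have "- ln \<bar>sin t\<bar> \<ge> 0" using s abs_sin_le_one[of t] by (simp add: ln_le_zero_iff)
          moreover have "w (2 * cos t) \<ge> 0" "- 2 * sin t \<ge> 0" using w s by linarith+
          ultimately show ?thesis
            by (simp only: ennreal_plus[OF mult_nonneg_nonneg] ennreal_mult)
        qed
        finally show ?thesis using True by simp
      next
        case False
        thus ?thesis using s unfolding sqrt_eq[OF True] by (simp add: ereal_ln_def e2ennreal_neg)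
      qed
    qed simp
  qed
  also have "\<dots> = (\<integral>\<^sup>+t. ennreal (w (2 * cos t)) * ennreal (- 2 * sin t) * indicator {pi..2 * pi} t \<partial>lborel) +
      (\<integral>\<^sup>+t. ennreal (- ln \<bar>sin t\<bar>) * indicator {0..2 * pi} t \<partial>lborel)"
    by (rule nn_integral_add) measurable
  also have "\<dots> = ?I (\<lambda>x. ennreal (w x)) + (\<integral>\<^sup>+t. ennreal (- ln \<bar>sin t\<bar>) \<partial>circle_measure)"
    by (subst nn_integral_cos_substitution) (auto simp: nn_integral_restrict_space)
  also have "\<dots> < \<infinity>" using fin nn_integral_neg_ln_sin by simp
  finally have P: "?I (\<lambda>x. e2ennreal (?h x)) < \<infinity>" .
  have "- \<infinity> < enn2ereal (?I (\<lambda>x. e2ennreal (?h x))) - enn2ereal (?I (\<lambda>x. e2ennreal (- ?h x)))"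
    using szego unfolding szego_condition_def ereal_integral_def by (simp add: nn_integral_restrict_space)
  hence N: "?I (\<lambda>x. e2ennreal (- ?h x)) < \<infinity>"
    using P by (cases "?I (\<lambda>x. e2ennreal (?h x))"; cases "?I (\<lambda>x. e2ennreal (- ?h x))") auto
  have "(\<integral>\<^sup>+t. (if 0 < w (2 * cos t) then ennreal (- ln (w (2 * cos t))) else \<infinity>) * indicator {pi..2*pi} t \<partial>lborel) =
    (\<integral>\<^sup>+t. e2ennreal (- ?h (2 * cos t)) * ennreal (- 2 * sin t) * indicator {pi..2 * pi} t \<partial>lborel)"
  proof (rule nn_integral_cong_AE, use AE in eventually_elim)
    case (elim t)
    show ?case
    proof (cases "t \<in> {pi..2 * pi}")
      case True
      note s = spos[OF True elim[rule_format, OF True]]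
      show ?thesis
        using s unfolding sqrt_eq[OF True]
        by (auto simp: ereal_ln_def ennreal_top_mult simp flip: ennreal_mult'')
    qed simp
  qed
  also have "\<dots> = ?I (\<lambda>x. e2ennreal (- ?h x))"
    by (rule nn_integral_cos_substitution[symmetric]) measurable
  finally show ?thesis using N by simp
qed

text \<open>The parameter runs over the lower semicircle, while \<open>circ\<close> lies on the
  upper one.\<close>

lemma circ_cos: "t \<in> {pi..2 * pi} \<Longrightarrow> circ (2 * cos t) = cnj (cis t)"
proof -
  assume t: "t \<in> {pi..2 * pi}"
  have "- sin t \<ge> 0" using t sin_ge_zero[of "t - pi"] by simp
  moreover have "4 - (2 * cos t)\<^sup>2 = (2 * (- sin t))\<^sup>2"
    by (simp add: power_mult_distrib cos_squared_eq)
  ultimately have "sqrt (4 - (2 * cos t)\<^sup>2) = 2 * (- sin t)" by (metis mult_nonneg_nonneg real_sqrt_unique zero_le_numeral)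
  thus ?thesis by (simp add: circ_def complex_eq_iff)
qed

lemma poly_real_cnj: "poly (map_poly complex_of_real Q) (cnj z) = cnj (poly (map_poly complex_of_real Q) z)"
  by (induction Q) (auto simp: map_poly_pCons)

text \<open>Jensen's inequality is applied to Q times 1 - zeta^2. The extra factor is 1 at 0, and
  its squared modulus 4 (sin t)^2 is at most twice the Jacobian 2 |sin t| of x = 2 cos t, so the
  circle integral with weight V is dominated by the integral against w dx.\<close>

theorem szego_lower_bound:
  assumes w [measurable]: "w \<in> borel_measurable borel" and w0: "\<And>x. 0 \<le> w x"
    and fin: "(\<integral>\<^sup>+x. ennreal (w x) * indicator {-2..2} x \<partial>lborel) < \<infinity>"
    and szego: "szego_condition w"
  shows "\<exists>c>0. \<forall>Q. coeff Q 0 = 1 \<longrightarrow>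
    ennreal c \<le> (\<integral>\<^sup>+x. ennreal ((cmod (circ_poly Q x))\<^sup>2 * w x) * indicator {-2..2} x \<partial>lborel)"
proof -
  let ?L = "\<lambda>t. (if 0 < w (2 * cos t) then ennreal (- ln (w (2 * cos t))) else \<infinity>) * indicator {pi..2*pi} t"
  note logint = szego_imp_log_integrable[OF assms]
  have "AE t in lborel. ?L t \<noteq> \<infinity>"
    by (rule nn_integral_PInf_AE) (use logint in auto)
  hence wpos: "AE t in lborel. t \<in> {pi..2 * pi} \<longrightarrow> 0 < w (2 * cos t)"
    by eventually_elim (auto split: if_splits)
  \<comment> \<open>Truncation at 1 suits \<open>jensen_lower_bound\<close>; the value 1 where w = 0
    keeps V positive and concerns only a null set, by \<open>wpos\<close>.\<close>
  define V where "V t = (if 0 < w (2 * cos t) then min 1 (w (2 * cos t)) else 1)" for t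
  have V: "0 < V t" "V t \<le> 1" "V (2 * pi - t) = V t" for t
    unfolding V_def by (auto simp: cos_diff)
  have [measurable]: "V \<in> borel_measurable borel" unfolding V_def by measurable
  have Vm: "V \<in> borel_measurable circle_measure" by (rule measurable_restrict_space1) measurable
  have "(\<integral>\<^sup>+t. ennreal (- ln (V t)) \<partial>circle_measure) =
      2 * (\<integral>\<^sup>+t. ennreal (- ln (V t)) * indicator {pi..2 * pi} t \<partial>lborel)"
    by (rule nn_integral_circle_symmetric) (use V(3) in auto)
  also have "\<dots> \<le> 2 * (\<integral>\<^sup>+t. ?L t \<partial>lborel)"
  proof (intro mult_left_mono nn_integral_mono_AE, use wpos in eventually_elim)
    case (elim t)
    thus ?case by (auto simp: V_def min_def indicator_def intro!: ennreal_leI)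
  qed simp
  also have "\<dots> < \<infinity>" using logint by (simp add: ennreal_mult_less_top)
  finally have "(\<integral>\<^sup>+t. ennreal (- ln (V t)) \<partial>circle_measure) < \<infinity>" .
  hence int: "integrable circle_measure (\<lambda>t. ln (V t))"
    using V Vm by (intro integrableI_bounded) (auto simp: abs_of_nonpos)
  define c where "c = 2 * pi * exp ((\<integral>t. ln (V t) \<partial>circle_measure) / (2 * pi))"
  have "c > 0" by (simp add: c_def)
  \<comment> \<open>One factor 2 comes from the two halves of the circle, the other from 4 (sin t)^2
    \<le> 2 (2 |sin t|).\<close>
  have "ennreal (c / 4) \<le> (\<integral>\<^sup>+x. ennreal ((cmod (circ_poly Q x))\<^sup>2 * w x) * indicator {-2..2} x \<partial>lborel)"
    if Q: "coeff Q 0 = 1" for Q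
  proof -
    define R where "R = map_poly complex_of_real (Q * [:1,0,-1:])"
    have R: "poly R (cis t) = cnj (circ_poly Q (2 * cos t)) * (1 - cis t ^ 2)" if "t \<in> {pi..2*pi}" for t
    proof -
      have "cnj (poly R (cis t)) = circ_poly (Q * [:1,0,-1:]) (2 * cos t)"
        unfolding R_def circ_poly_def circ_cos[OF that] poly_real_cnj ..
      also have "\<dots> = circ_poly Q (2 * cos t) * cnj (1 - cis t ^ 2)"
        using circ_cos[OF that] by (simp add: power2_eq_square algebra_simps)
      finally show ?thesis by (metis complex_cnj_cnj complex_cnj_mult)
    qed
    have "coeff R 0 = 1" using Q by (simp add: R_def coeff_map_poly coeff_mult)
    from jensen_lower_bound[OF Vm V(1,2) int this]
    have "ennreal c \<le> (\<integral>\<^sup>+t. ennreal ((cmod (poly R (cis t)))\<^sup>2 * V t) \<partial>circle_measure)"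
      by (simp add: c_def)
    also have "\<dots> = 2 * (\<integral>\<^sup>+t. ennreal ((cmod (poly R (cis t)))\<^sup>2 * V t) * indicator {pi..2 * pi} t \<partial>lborel)"
    proof (rule nn_integral_circle_symmetric)
      have "continuous_on UNIV (\<lambda>t. cmod (poly R (cis t)))" by (intro continuous_intros)
      hence [measurable]: "(\<lambda>t. cmod (poly R (cis t))) \<in> borel_measurable borel"
        by (rule borel_measurable_continuous_onI)
      show "(\<lambda>t. ennreal ((cmod (poly R (cis t)))\<^sup>2 * V t)) \<in> borel_measurable borel" by measurable
      fix t
      have "cis (2 * pi - t) = cnj (cis t)" by (simp add: complex_eq_iff cos_diff sin_diff)
      thus "ennreal ((cmod (poly R (cis (2 * pi - t))))\<^sup>2 * V (2 * pi - t)) = ennreal ((cmod (poly R (cis t)))\<^sup>2 * V t)"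
        unfolding V(3) R_def by (simp only: poly_real_cnj complex_mod_cnj)
    qed
    finally have c1: "ennreal c \<le>
      2 * (\<integral>\<^sup>+t. ennreal ((cmod (poly R (cis t)))\<^sup>2 * V t) * indicator {pi..2 * pi} t \<partial>lborel)" .
    have "(\<integral>\<^sup>+t. ennreal ((cmod (poly R (cis t)))\<^sup>2 * V t) * indicator {pi..2 * pi} t \<partial>lborel) \<le>
      (\<integral>\<^sup>+t. 2 * (ennreal ((cmod (circ_poly Q (2 * cos t)))\<^sup>2 * w (2 * cos t)) * ennreal (- 2 * sin t) *
        indicator {pi..2 * pi} t) \<partial>lborel)"
    proof (rule nn_integral_mono_AE, use wpos in eventually_elim)
      case (elim t)
      show ?case
      proof (cases "t \<in> {pi..2 * pi}")
        case True
        have s: "0 \<le> - sin t" "- sin t \<le> 1" using True sin_ge_zero[of "t - pi"] sin_ge_minus_one[of t] by auto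
        let ?q = "(cmod (circ_poly Q (2 * cos t)))\<^sup>2"
        have "(cmod (poly R (cis t)))\<^sup>2 * V t = ?q * (2 * \<bar>sin t\<bar>)\<^sup>2 * V t"
          unfolding R[OF True] by (simp add: norm_mult power_mult_distrib norm_one_minus_cis_square)
        also have "\<dots> \<le> ?q * (2 * (- 2 * sin t)) * w (2 * cos t)"
        proof (intro mult_mono mult_left_mono)
          have "(sin t)\<^sup>2 = (- sin t) * (- sin t)" by (simp add: power2_eq_square)
          also have "\<dots> \<le> - sin t" using s by (intro mult_left_le)
          finally show "(2 * \<bar>sin t\<bar>)\<^sup>2 \<le> 2 * (- 2 * sin t)" by (simp add: power_mult_distrib)
          show "V t \<le> w (2 * cos t)" using elim True by (simp add: V_def)
        qed (use V(1)[of t] s in \<open>auto simp: mult_nonpos_nonneg\<close>)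
        finally have "ennreal ((cmod (poly R (cis t)))\<^sup>2 * V t) \<le> ennreal (2 * (?q * w (2 * cos t) * (- 2 * sin t)))"
          by (intro ennreal_leI) (simp add: algebra_simps)
        also have "\<dots> = 2 * (ennreal (?q * w (2 * cos t)) * ennreal (- 2 * sin t))"
        proof -
          have a: "0 \<le> ?q * w (2 * cos t)" using w0 by simp
          have b: "0 \<le> - 2 * sin t" using s by simp
          show ?thesis
            by (simp only: ennreal_mult[OF zero_le_numeral mult_nonneg_nonneg[OF a b]]
                ennreal_mult[OF a b] ennreal_numeral)
        qed
        finally show ?thesis using True by simp
      qed simp
    qed
    also have "\<dots> = 2 * (\<integral>\<^sup>+x. ennreal ((cmod (circ_poly Q x))\<^sup>2 * w x) * indicator {-2..2} x \<partial>lborel)"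
    proof -
      have "(\<lambda>x. cmod (circ_poly Q x)) \<in> borel_measurable borel"
        by (intro borel_measurable_continuous_onI continuous_intros)
      hence [measurable]: "(\<lambda>x. ennreal ((cmod (circ_poly Q x))\<^sup>2 * w x)) \<in> borel_measurable borel" by measurable
      show ?thesis by (subst nn_integral_cos_substitution) (auto intro!: nn_integral_cmult)
    qed
    finally have "2 * (\<integral>\<^sup>+t. ennreal ((cmod (poly R (cis t)))\<^sup>2 * V t) * indicator {pi..2 * pi} t \<partial>lborel) \<le>
      2 * (2 * (\<integral>\<^sup>+x. ennreal ((cmod (circ_poly Q x))\<^sup>2 * w x) * indicator {-2..2} x \<partial>lborel))"
      by (rule mult_left_mono) simp
    from order.trans[OF c1 this]
    have "ennreal c \<le> 4 * (\<integral>\<^sup>+x. ennreal ((cmod (circ_poly Q x))\<^sup>2 * w x) * indicator {-2..2} x \<partial>lborel)"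
      by (simp add: mult.assoc[symmetric])
    hence "ennreal (1/4) * ennreal c \<le> ennreal (1/4) * (4 * (\<integral>\<^sup>+x. ennreal ((cmod (circ_poly Q x))\<^sup>2 * w x) * indicator {-2..2} x \<partial>lborel))"
      by (rule mult_left_mono) simp
    also have "ennreal (1/4) * ennreal c = ennreal (c / 4)" using \<open>c > 0\<close> by (simp flip: ennreal_mult)
    also have "ennreal (1/4) * (4 * X) = X" for X
    proof -
      have "ennreal (1/4) * 4 = 1"
        by (metis ennreal_1 ennreal_mult' ennreal_numeral nonzero_eq_divide_eq zero_le_numeral zero_neq_numeral divide_nonneg_nonneg zero_le_one)
      thus ?thesis by (simp add: mult.assoc[symmetric])
    qed
    finally show ?thesis .
  qed
  thus ?thesis using \<open>c > 0\<close> by (intro exI[of _ "c / 4"]) auto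
qed

section \<open>Measures with finitely many mass points outside the interval\<close>

text \<open>The complement of the support is a union of open null sets, and by Lindelof countably
  many of them suffice.\<close>

lemma AE_topological_support:
  fixes M :: "'a :: second_countable_topology measure"
  assumes "sets M = sets borel"
  shows "AE x in M. x \<in> topological_support M"
proof -
  let ?F = "{U. open U \<and> emeasure M U = 0}"
  obtain G where G: "G \<subseteq> ?F" "countable G" "\<Union>G = \<Union>?F"
    using Lindelof[of ?F] by blast
  have "(\<Union>U\<in>G. U) \<in> null_sets M"
  proof (rule null_sets_UN')
    show "U \<in> null_sets M" if "U \<in> G" for U
      using G(1) that by (auto simp: null_sets_def assms)
  qed (rule G)
  moreover have "{x \<in> space M. x \<notin> topological_support M} \<subseteq> \<Union>?F"
    by (auto simp: topological_support_def not_less)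
  ultimately show ?thesis using G(3) by (intro AE_I'[of "\<Union>G"]) auto
qed

text \<open>An isolated point of the support is an atom: a neighbourhood meeting the support only
  there has positive measure, all of it at the point.\<close>

lemma AE_essential_support:
  fixes M :: "'a :: {second_countable_topology, t1_space} measure"
  assumes M: "sets M = sets borel"
  shows "AE x in M. x \<in> essential_support M \<or> emeasure M {x} > 0"
  using AE_topological_support[OF M]
proof eventually_elim
  case (elim x)
  show ?case
  proof (cases "x isolated_in topological_support M")
    case True
    then obtain T where T: "open T" "T \<inter> topological_support M = {x}"
      unfolding isolated_in_def by blast
    have "0 < emeasure M T" using T elim unfolding topological_support_def by blast
    also have "emeasure M T = emeasure M {x}"
    proof (rule emeasure_eq_AE)
      show "AE y in M. y \<in> T \<longleftrightarrow> y \<in> {x}"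
        using AE_topological_support[OF M] by eventually_elim (use T(2) in auto)
    qed (use T(1) M in auto)
    finally show ?thesis by simp
  qed (use elim in \<open>auto simp: essential_support_def\<close>)
qed

text \<open>Otherwise the open set where p does not vanish is null and the support lies among
  finitely many roots. This yields definiteness of the moments.\<close>

lemma not_AE_poly_eq_0:
  fixes M :: "real measure" and p :: "real poly"
  assumes M: "sets M = sets borel" and S: "infinite (topological_support M)" and p: "p \<noteq> 0"
  shows "\<not> (AE x in M. poly p x = 0)"
proof
  assume AE: "AE x in M. poly p x = 0"
  have U: "open {x. poly p x \<noteq> 0}"
    by (intro open_Collect_neq continuous_intros)
  have "emeasure M {x. poly p x \<noteq> 0} = emeasure M {}"
    by (rule emeasure_eq_AE) (use AE U M in auto)
  hence "topological_support M \<subseteq> {x. poly p x = 0}"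
    using U unfolding topological_support_def by (auto dest!: spec[of _ "{x. poly p x \<noteq> 0}"])
  thus False using S p poly_roots_finite finite_subset by blast
qed

section \<open>Comparison with the absolutely continuous part\<close>

lemma nn_integral_mono_emeasure:
  assumes sets: "sets N = sets M" and le: "\<And>A. A \<in> sets M \<Longrightarrow> emeasure N A \<le> emeasure M A"
    and f: "f \<in> borel_measurable M"
  shows "(\<integral>\<^sup>+x. f x \<partial>N) \<le> (\<integral>\<^sup>+x. f x \<partial>M)"
  using f
proof (induction f rule: borel_measurable_induct)
  case (cong f g)
  have "space N = space M" using sets by (rule sets_eq_imp_space_eq)
  with cong show ?case by (metis nn_integral_cong)
next
  case (set A)
  thus ?case using le sets by simp
next
  case (mult u c)
  have [measurable]: "u \<in> borel_measurable N" using mult sets by (simp cong: measurable_cong_sets)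
  show ?case using mult by (simp add: nn_integral_cmult mult_left_mono)
next
  case (add u v)
  have [measurable]: "u \<in> borel_measurable N" "v \<in> borel_measurable N"
    using add sets by (simp_all cong: measurable_cong_sets)
  show ?case using add by (simp add: nn_integral_add add_mono)
next
  case (seq U)
  have m: "U i \<in> borel_measurable N" for i using seq sets by (simp cong: measurable_cong_sets)
  have "(\<integral>\<^sup>+x. (SUP i. U i) x \<partial>N) = (SUP i. \<integral>\<^sup>+x. U i x \<partial>N)"
    using nn_integral_monotone_convergence_SUP[OF \<open>incseq U\<close> m] by (simp add: image_comp)
  also have "\<dots> \<le> (SUP i. \<integral>\<^sup>+x. U i x \<partial>M)" using seq by (intro SUP_mono) blast
  also have "\<dots> = (\<integral>\<^sup>+x. (SUP i. U i) x \<partial>M)"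
    using nn_integral_monotone_convergence_SUP[OF \<open>incseq U\<close> \<open>\<And>i. U i \<in> borel_measurable M\<close>] by (simp add: image_comp)
  finally show ?case .
qed

lemma ac_part_density_nn_integral_le:
  assumes w: "ac_part_density M w" and M: "sets M = sets borel" and f: "f \<in> borel_measurable borel"
  shows "(\<integral>\<^sup>+x. ennreal (w x) * f x \<partial>lborel) \<le> (\<integral>\<^sup>+x. f x \<partial>M)"
proof -
  have [measurable]: "w \<in> borel_measurable borel" using w by (simp add: ac_part_density_def)
  obtain N where N: "\<And>B. B \<in> sets borel \<Longrightarrow>
      emeasure M B = emeasure (density lborel (\<lambda>x. ennreal (w x))) B + emeasure N B"
    using w unfolding ac_part_density_def by blast
  have "(\<integral>\<^sup>+x. ennreal (w x) * f x \<partial>lborel) = (\<integral>\<^sup>+x. f x \<partial>density lborel (\<lambda>x. ennreal (w x)))"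
    using f by (subst nn_integral_density) auto
  also have "\<dots> \<le> (\<integral>\<^sup>+x. f x \<partial>M)"
  proof (rule nn_integral_mono_emeasure)
    show "f \<in> borel_measurable M" using f M by (simp cong: measurable_cong_sets)
  qed (use N M in auto)
  finally show ?thesis .
qed

lemma finite_measure_density_continuous:
  fixes f :: "real \<Rightarrow> real"
  assumes M: "finite_measure M" "sets M = sets borel" "AE x in M. \<bar>x\<bar> \<le> B"
    and f: "continuous_on UNIV f" "\<And>x. 0 \<le> f x"
  shows "finite_measure (density M (\<lambda>x. ennreal (f x)))"
proof (rule finite_measureI)
  have int: "integrable M f" by (rule integrable_continuous_bounded_support[OF M f(1)])
  have "emeasure (density M (\<lambda>x. ennreal (f x))) (space M) = (\<integral>\<^sup>+x. ennreal (f x) \<partial>M)"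
    using int by (subst emeasure_density) (auto intro!: nn_integral_cong)
  also have "\<dots> = ennreal (integral\<^sup>L M f)" using int f(2) by (intro nn_integral_eq_integral) auto
  finally show "emeasure (density M (\<lambda>x. ennreal (f x))) (space (density M (\<lambda>x. ennreal (f x)))) \<noteq> \<infinity>"
    by simp
qed

text \<open>The density \<open>w\<close> stays fixed while \<mu> acquires a factor (x - y)^2 for
  each mass point; \<kappa> records how \<mu> still dominates w on the interval. Thus the Szego
  condition is used once, in the base case.\<close>

theorem monic_norm_limit_szego:
  fixes \<mu> :: "real measure"
  assumes "finite F" and F: "F \<inter> {-2..2} = {}"
    and w [measurable]: "w \<in> borel_measurable borel" and w0: "\<And>x. 0 \<le> w x"
    and wfin: "(\<integral>\<^sup>+x. ennreal (w x) * indicator {-2..2} x \<partial>lborel) < \<infinity>"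
    and szego: "szego_condition w"
    and \<mu>: "finite_measure \<mu>" "sets \<mu> = sets borel" "AE x in \<mu>. x \<in> {-2..2} \<union> F"
    and mass: "\<And>y. y \<in> F \<Longrightarrow> emeasure \<mu> {y} > 0"
    and \<kappa>: "\<kappa> > 0" "\<And>f. f \<in> borel_measurable borel \<Longrightarrow>
      ennreal \<kappa> * (\<integral>\<^sup>+x. f x * ennreal (w x) * indicator {-2..2} x \<partial>lborel) \<le> (\<integral>\<^sup>+x. f x \<partial>\<mu>)"
  shows "\<exists>E>0. monic_norm_limit \<mu> E"
  using assms(1,2) \<mu> mass \<kappa>
proof (induction F arbitrary: \<mu> \<kappa> rule: finite_induct)
  case empty
  obtain c where c: "c > 0" "\<And>Q. coeff Q 0 = 1 \<Longrightarrow>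
    ennreal c \<le> (\<integral>\<^sup>+x. ennreal ((cmod (circ_poly Q x))\<^sup>2 * w x) * indicator {-2..2} x \<partial>lborel)"
    using szego_lower_bound[OF w w0 wfin szego] by blast
  have B: "AE x in \<mu>. \<bar>x\<bar> \<le> 2" using empty.prems(4) by eventually_elim auto
  show ?case
  proof (rule monic_norm_limit_interval)
    show "AE x in \<mu>. x \<in> {-2..2}" using empty.prems(4) by simp
    show "\<kappa> * c > 0" using empty.prems(6) c(1) by simp
    fix Q :: "real poly" assume Q: "coeff Q 0 = 1"
    let ?q = "\<lambda>x. (cmod (circ_poly Q x))\<^sup>2"
    have cont: "continuous_on UNIV ?q" by (intro continuous_intros)
    hence [measurable]: "?q \<in> borel_measurable borel" by (rule borel_measurable_continuous_onI)
    have "ennreal (\<kappa> * c) \<le> ennreal \<kappa> * (\<integral>\<^sup>+x. ennreal (?q x * w x) * indicator {-2..2} x \<partial>lborel)"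
      using c(2)[OF Q] empty.prems(6) c(1) by (simp add: ennreal_mult mult_left_mono)
    also have "\<dots> = ennreal \<kappa> * (\<integral>\<^sup>+x. ennreal (?q x) * ennreal (w x) * indicator {-2..2} x \<partial>lborel)"
      using w0 by (simp add: ennreal_mult)
    also have "\<dots> \<le> (\<integral>\<^sup>+x. ennreal (?q x) \<partial>\<mu>)" by (rule empty.prems(7)) measurable
    also have "\<dots> = ennreal (\<integral>x. ?q x \<partial>\<mu>)"
      by (intro nn_integral_eq_integral integrable_continuous_bounded_support[OF empty.prems(2,3) B] cont) auto
    finally show "\<kappa> * c \<le> (\<integral>x. ?q x \<partial>\<mu>)" by (subst (asm) ennreal_le_iff) auto
  qed (use empty.prems in auto)
next
  case (insert y F)
  note prems = insert.prems
  interpret finite_measure \<mu> by (rule prems(2))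
  note [measurable_cong] = prems(3)
  define B where "B = 2 + (\<Sum>z\<in>insert y F. \<bar>z\<bar>)"
  have B: "AE x in \<mu>. \<bar>x\<bar> \<le> B"
    using prems(4)
  proof eventually_elim
    case (elim x)
    show ?case
    proof (cases "x \<in> {-2..2}")
      case True
      hence "\<bar>x\<bar> \<le> 2" by auto
      moreover have "(\<Sum>z\<in>insert y F. \<bar>z\<bar>) \<ge> 0" by (rule sum_nonneg) simp
      ultimately show ?thesis unfolding B_def by linarith
    next
      case False
      hence "x \<in> insert y F" using elim by auto
      hence "\<bar>x\<bar> \<le> (\<Sum>z\<in>insert y F. \<bar>z\<bar>)" using insert.hyps(1) by (intro member_le_sum) auto
      thus ?thesis by (simp add: B_def)
    qed
  qed
  have y: "\<bar>y\<bar> > 2" using prems(1) by auto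
  \<comment> \<open>The distance of y from [-2,2] and the remaining mass points.\<close>
  define d where "d = Min (insert (\<bar>y\<bar> - 2) ((\<lambda>z. \<bar>z - y\<bar>) ` F))"
  have d: "d > 0" unfolding d_def using insert.hyps y by (subst Min_gr_iff) auto
  have isolated: "AE x in \<mu>. x = y \<or> d \<le> \<bar>x - y\<bar>"
    using prems(4)
  proof eventually_elim
    case (elim x)
    consider "x \<in> {-2..2}" | "x = y" | "x \<in> F" using elim by auto
    thus ?case
    proof cases
      case 1
      have "d \<le> \<bar>y\<bar> - 2" unfolding d_def using insert.hyps by (intro Min_le) auto
      thus ?thesis using 1 by auto
    next
      case 3
      have "d \<le> \<bar>x - y\<bar>" unfolding d_def using insert.hyps 3 by (intro Min_le) auto
      thus ?thesis by simp
    qed auto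
  qed
  let ?M = "density \<mu> (\<lambda>x. ennreal ((x - y)\<^sup>2))"
  have "\<exists>E>0. monic_norm_limit ?M E"
  proof (rule insert.IH)
    show "F \<inter> {-2..2} = {}" using prems(1) by auto
    show "finite_measure ?M"
      by (rule finite_measure_density_continuous[OF prems(2,3) B]) (auto intro!: continuous_intros)
    show "AE x in ?M. x \<in> {-2..2} \<union> F"
    proof -
      have "AE x in \<mu>. 0 < ennreal ((x - y)\<^sup>2) \<longrightarrow> x \<in> {-2..2} \<union> F"
        using prems(4) by eventually_elim auto
      thus ?thesis by (subst AE_density) auto
    qed
    show "emeasure ?M {z} > 0" if z: "z \<in> F" for z
    proof -
      have "emeasure ?M {z} = (\<integral>\<^sup>+x. ennreal ((x - y)\<^sup>2) * indicator {z} x \<partial>\<mu>)"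
        using prems(3) by (subst emeasure_density) auto
      also have "\<dots> = ennreal ((z - y)\<^sup>2) * emeasure \<mu> {z}"
        using prems(3) by (subst nn_integral_indicator_singleton) auto
      also have "\<dots> > 0" using z prems(5)[of z] insert.hyps(2) by (auto simp: ennreal_zero_less_mult_iff)
      finally show ?thesis .
    qed
    \<comment> \<open>(|y| - 2)^2 is the minimum of (x - y)^2 on [-2,2].\<close>
    show "\<kappa> * (\<bar>y\<bar> - 2)\<^sup>2 > 0" using prems(6) y by simp
    fix f :: "real \<Rightarrow> ennreal" assume f [measurable]: "f \<in> borel_measurable borel"
    have "ennreal (\<kappa> * (\<bar>y\<bar> - 2)\<^sup>2) * (\<integral>\<^sup>+x. f x * ennreal (w x) * indicator {-2..2} x \<partial>lborel) =
      ennreal \<kappa> * (\<integral>\<^sup>+x. ennreal ((\<bar>y\<bar> - 2)\<^sup>2) * (f x * ennreal (w x) * indicator {-2..2} x) \<partial>lborel)"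
      using prems(6) by (subst nn_integral_cmult) (auto simp: ennreal_mult mult.assoc)
    also have "\<dots> \<le> ennreal \<kappa> * (\<integral>\<^sup>+x. (ennreal ((x - y)\<^sup>2) * f x) * ennreal (w x) * indicator {-2..2} x \<partial>lborel)"
    proof (intro mult_left_mono nn_integral_mono)
      fix x
      show "ennreal ((\<bar>y\<bar> - 2)\<^sup>2) * (f x * ennreal (w x) * indicator {-2..2} x) \<le>
        (ennreal ((x - y)\<^sup>2) * f x) * ennreal (w x) * indicator {-2..2} x"
      proof (cases "x \<in> {-2..2}")
        case True
        hence "\<bar>\<bar>y\<bar> - 2\<bar> \<le> \<bar>x - y\<bar>" using y by auto
        hence "ennreal ((\<bar>y\<bar> - 2)\<^sup>2) \<le> ennreal ((x - y)\<^sup>2)"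
          by (intro ennreal_leI) (simp add: abs_le_square_iff)
        hence "ennreal ((\<bar>y\<bar> - 2)\<^sup>2) * (f x * ennreal (w x)) \<le> ennreal ((x - y)\<^sup>2) * (f x * ennreal (w x))"
          by (rule mult_right_mono) simp
        thus ?thesis using True by (simp add: mult.assoc)
      qed simp
    qed simp
    also have "\<dots> \<le> (\<integral>\<^sup>+x. ennreal ((x - y)\<^sup>2) * f x \<partial>\<mu>)" by (rule prems(7)) measurable
    also have "\<dots> = (\<integral>\<^sup>+x. f x \<partial>?M)" by (subst nn_integral_density) auto
    finally show "ennreal (\<kappa> * (\<bar>y\<bar> - 2)\<^sup>2) * (\<integral>\<^sup>+x. f x * ennreal (w x) * indicator {-2..2} x \<partial>lborel) \<le>
      (\<integral>\<^sup>+x. f x \<partial>?M)" .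
  qed (use prems(3) in auto)
  then obtain E where E: "E > 0" "monic_norm_limit ?M E" by blast
  have "measure \<mu> {y} > 0" using prems(5)[of y] by (simp add: emeasure_eq_measure)
  from monic_norm_limit_mass_point[OF prems(2,3) B isolated d this E(2,1)] E(1)
  show ?case by blast
qed

section \<open>The evolved measure\<close>

text \<open>Dominates the difference quotients of exp (x^2 t) uniformly over bounded steps.\<close>

lemma abs_exp_minus_one_le: "\<bar>exp u - 1\<bar> \<le> \<bar>u\<bar> * exp \<bar>u\<bar>" for u :: real
proof (cases "u \<ge> 0")
  case True
  have "1 - u \<le> exp (- u)" using exp_ge_add_one_self[of "- u"] by simp
  hence "exp u * (1 - u) \<le> exp u * exp (- u)" by (intro mult_left_mono) auto
  thus ?thesis using True by (simp add: exp_minus algebra_simps)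
next
  case False
  have "1 - exp u \<le> - u" using exp_ge_add_one_self[of u] by linarith
  also have "\<dots> = - u * 1" by simp
  also have "\<dots> \<le> - u * exp (- u)" using False by (intro mult_left_mono) auto
  finally show ?thesis using False by simp
qed

lemma has_real_derivative_integral_exp_square:
  fixes M :: "real measure"
  assumes M: "finite_measure M" "sets M = sets borel" "AE x in M. \<bar>x\<bar> \<le> B"
  shows "((\<lambda>t. \<integral>x. x ^ k * exp (x\<^sup>2 * t) \<partial>M) has_real_derivative (\<integral>x. x ^ (k + 2) * exp (x\<^sup>2 * t) \<partial>M)) (at t)"
  unfolding DERIV_def
proof (subst tendsto_at_iff_sequentially, intro allI impI)
  note int = integrable_continuous_bounded_support[OF M]
  fix X :: "nat \<Rightarrow> real" assume X: "\<forall>i. X i \<in> UNIV - {0}" "X \<longlonglongrightarrow> 0"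
  let ?f = "\<lambda>i x. x ^ k * exp (x\<^sup>2 * t) * ((exp (x\<^sup>2 * X i) - 1) / X i)"
  have eq: "((\<integral>x. x ^ k * exp (x\<^sup>2 * (t + X i)) \<partial>M) - (\<integral>x. x ^ k * exp (x\<^sup>2 * t) \<partial>M)) / X i = (\<integral>x. ?f i x \<partial>M)" for i
  proof -
    have "(\<integral>x. x ^ k * exp (x\<^sup>2 * (t + X i)) \<partial>M) - (\<integral>x. x ^ k * exp (x\<^sup>2 * t) \<partial>M) =
        (\<integral>x. x ^ k * exp (x\<^sup>2 * (t + X i)) - x ^ k * exp (x\<^sup>2 * t) \<partial>M)"
      by (rule Bochner_Integration.integral_diff[symmetric]; intro int continuous_intros)
    hence "((\<integral>x. x ^ k * exp (x\<^sup>2 * (t + X i)) \<partial>M) - (\<integral>x. x ^ k * exp (x\<^sup>2 * t) \<partial>M)) / X i =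
        (\<integral>x. (x ^ k * exp (x\<^sup>2 * (t + X i)) - x ^ k * exp (x\<^sup>2 * t)) / X i \<partial>M)"
      by simp
    also have "\<dots> = (\<integral>x. ?f i x \<partial>M)"
      by (intro Bochner_Integration.integral_cong refl) (simp add: exp_add algebra_simps diff_divide_distrib)
    finally show ?thesis .
  qed
  obtain C where C: "\<And>i. \<bar>X i\<bar> \<le> C"
    using X(2) convergent_imp_Bseq[of X] unfolding Bseq_def convergent_def by auto
  have "(\<lambda>i. \<integral>x. ?f i x \<partial>M) \<longlonglongrightarrow> (\<integral>x. x ^ (k + 2) * exp (x\<^sup>2 * t) \<partial>M)"
  proof (rule integral_dominated_convergence[where w = "\<lambda>x. \<bar>x ^ k * exp (x\<^sup>2 * t)\<bar> * (x\<^sup>2 * exp (x\<^sup>2 * C))"])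
    show "(\<lambda>x. x ^ (k + 2) * exp (x\<^sup>2 * t)) \<in> borel_measurable M"
      by (intro borel_measurable_integrable int continuous_intros)
    show "?f i \<in> borel_measurable M" for i
      by (intro borel_measurable_integrable int continuous_intros) (use X in auto)
    show "integrable M (\<lambda>x. \<bar>x ^ k * exp (x\<^sup>2 * t)\<bar> * (x\<^sup>2 * exp (x\<^sup>2 * C)))"
      by (intro int continuous_intros)
    show "AE x in M. (\<lambda>i. ?f i x) \<longlonglongrightarrow> x ^ (k + 2) * exp (x\<^sup>2 * t)"
    proof (rule AE_I2)
      fix x
      have "((\<lambda>t. exp (x\<^sup>2 * t)) has_real_derivative x\<^sup>2) (at 0)"
        by (auto intro!: derivative_eq_intros)
      hence "((\<lambda>h. (exp (x\<^sup>2 * h) - 1) / h) \<longlongrightarrow> x\<^sup>2) (at 0)" by (simp add: DERIV_def)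
      hence "(\<lambda>i. (exp (x\<^sup>2 * X i) - 1) / X i) \<longlonglongrightarrow> x\<^sup>2"
        using X unfolding tendsto_at_iff_sequentially by (simp add: o_def)
      hence "(\<lambda>i. ?f i x) \<longlonglongrightarrow> x ^ k * exp (x\<^sup>2 * t) * x\<^sup>2" by (intro tendsto_intros)
      thus "(\<lambda>i. ?f i x) \<longlonglongrightarrow> x ^ (k + 2) * exp (x\<^sup>2 * t)"
        by (simp add: power_add algebra_simps power2_eq_square)
    qed
    show "AE x in M. norm (?f i x) \<le> \<bar>x ^ k * exp (x\<^sup>2 * t)\<bar> * (x\<^sup>2 * exp (x\<^sup>2 * C))" for i
    proof (rule AE_I2)
      fix x
      have "\<bar>exp (x\<^sup>2 * X i) - 1\<bar> \<le> x\<^sup>2 * \<bar>X i\<bar> * exp (x\<^sup>2 * \<bar>X i\<bar>)"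
        using abs_exp_minus_one_le[of "x\<^sup>2 * X i"] by (simp add: abs_mult)
      also have "\<dots> \<le> x\<^sup>2 * \<bar>X i\<bar> * exp (x\<^sup>2 * C)"
        using C[of i] by (intro mult_left_mono) (auto intro: mult_left_mono)
      finally have "\<bar>(exp (x\<^sup>2 * X i) - 1) / X i\<bar> \<le> x\<^sup>2 * exp (x\<^sup>2 * C)"
        using X(1) by (simp add: divide_le_eq algebra_simps)
      thus "norm (?f i x) \<le> \<bar>x ^ k * exp (x\<^sup>2 * t)\<bar> * (x\<^sup>2 * exp (x\<^sup>2 * C))"
        unfolding real_norm_def abs_mult[of "x ^ k * exp (x\<^sup>2 * t)"] by (intro mult_left_mono) auto
    qed
  qed
  thus "((\<lambda>h. ((\<integral>x. x ^ k * exp (x\<^sup>2 * (t + h)) \<partial>M) - (\<integral>x. x ^ k * exp (x\<^sup>2 * t) \<partial>M)) / h) \<circ> X) \<longlonglongrightarrow>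
      (\<integral>x. x ^ (k + 2) * exp (x\<^sup>2 * t) \<partial>M)"
    unfolding o_def eq .
qed

text \<open>In \<open>volterra_coeff\<close> the exponents n + 2 and n balance twice n + 1, so
  normalising the measure does not change the coefficients.\<close>

lemma hankel_det_scale: "hankel_det (\<lambda>k. c * s k) m = c ^ m * hankel_det s m"
proof -
  have "mat m m (\<lambda>(i, j). c * s (i + j)) = c \<cdot>\<^sub>m mat m m (\<lambda>(i, j). s (i + j))"
    by (rule eq_matI) auto
  thus ?thesis unfolding hankel_det_def by (simp add: det_smult)
qed

lemma moment_functional_eq_integral:
  assumes "\<And>k. integrable M (\<lambda>x. x ^ k * f x)"
  shows "moment_functional (\<lambda>k. \<integral>x. x ^ k * f x \<partial>M) p = (\<integral>x. poly p x * f x \<partial>M)"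
proof -
  have "(\<integral>x. poly p x * f x \<partial>M) = (\<integral>x. (\<Sum>i\<le>degree p. coeff p i * (x ^ i * f x)) \<partial>M)"
    by (intro Bochner_Integration.integral_cong refl) (simp add: poly_altdef sum_distrib_right mult.assoc)
  also have "\<dots> = moment_functional (\<lambda>k. \<integral>x. x ^ k * f x \<partial>M) p"
    unfolding moment_functional_def
    by (subst Bochner_Integration.integral_sum) (use assms in auto)
  finally show ?thesis by simp
qed

lemma even_measure_odd_integral:
  fixes f :: "real \<Rightarrow> real"
  assumes M: "even_measure M" and f: "f \<in> borel_measurable borel" and odd: "\<And>x. f (- x) = - f x"
  shows "(\<integral>x. f x \<partial>M) = 0"
proof -
  have eq: "distr M borel uminus = M" using M by (simp add: even_measure_def)
  hence sets: "sets M = sets borel" by (metis sets_distr)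
  have "(\<integral>x. f x \<partial>M) = (\<integral>x. f x \<partial>distr M borel uminus)" unfolding eq ..
  also have "\<dots> = (\<integral>x. f (- x) \<partial>M)"
    by (rule integral_distr) (use f in \<open>auto cong: measurable_cong_sets[OF sets refl]\<close>)
  also have "\<dots> = - (\<integral>x. f x \<partial>M)" by (simp add: odd)
  finally show ?thesis by simp
qed

text \<open>\<open>P n\<close> is monic, which gives the lower bound, and minimal by
  \<open>h_minimal\<close>, which gives the upper one.\<close>

lemma monic_norm_limit_orthopoly:
  assumes "even_definite_moments s" and L: "\<And>p. moment_functional s (p * p) = (\<integral>x. (poly p x)\<^sup>2 \<partial>M)"
    and lim: "monic_norm_limit M E"
  shows "(\<lambda>n. orthopoly_norm s n) \<longlonglongrightarrow> E"
proof (rule LIMSEQ_I)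
  interpret even_definite_moments s by fact
  fix r :: real assume r: "r > 0"
  hence "r / 2 > 0" by simp
  then obtain N where N: "\<And>n P. n \<ge> N \<Longrightarrow> degree P = n \<and> lead_coeff P = 1 \<Longrightarrow> E - r / 2 \<le> (\<integral>x. (poly P x)\<^sup>2 \<partial>M)"
    "\<And>n. n \<ge> N \<Longrightarrow> \<exists>P. degree P = n \<and> lead_coeff P = 1 \<and> (\<integral>x. (poly P x)\<^sup>2 \<partial>M) \<le> E + r / 2"
    using lim unfolding monic_norm_limit_def by blast
  show "\<exists>N. \<forall>n\<ge>N. norm (orthopoly_norm s n - E) < r"
  proof (intro exI[of _ N] allI impI)
    fix n assume n: "n \<ge> N"
    have "E - r / 2 \<le> h n"
      unfolding orthopoly_norm_def L using N(1)[OF n] orthopoly_monic_degree by blast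
    moreover obtain P where P: "degree P = n" "lead_coeff P = 1" "(\<integral>x. (poly P x)\<^sup>2 \<partial>M) \<le> E + r / 2"
      using N(2)[OF n] by blast
    have "h n \<le> E + r / 2" using h_minimal[OF P(1,2)] P(3) unfolding L by linarith
    ultimately show "norm (orthopoly_norm s n - E) < r" using r by (simp add: abs_less_iff)
  qed
qed

text \<open>Integrability is asserted along with the moments because a Bochner integral that fails
  to exist has the value 0. The derivative at t = 0 is one-sided.\<close>

theorem theorem1:
  fixes \<rho> :: "real measure" and w :: "real \<Rightarrow> real" and T :: ereal
  assumes "real_distribution \<rho>"
    and "even_measure \<rho>"
    and "essential_support \<rho> = {-2..2}"
    and "finite {\<xi>. \<xi> \<notin> {-2..2} \<and> emeasure \<rho> {\<xi>} > 0}"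
    and "ac_part_density \<rho> w"
    and "szego_condition w"
    and "0 < T"
  defines "J \<equiv> {t::real. 0 \<le> t \<and> ereal t < T}"
    and "a \<equiv> volterra_coeff \<rho>"
  shows "(\<forall>t\<in>J. integrable \<rho> (\<lambda>\<xi>. exp (\<xi>\<^sup>2 * t)) \<and> prob_space (evolved_measure \<rho> t)) \<and>
         (\<forall>t\<in>J. \<forall>k. integrable (evolved_measure \<rho> t) (\<lambda>\<xi>. \<xi> ^ k)) \<and>
         (\<forall>t\<in>J. \<forall>k. odd k \<longrightarrow> moment (evolved_measure \<rho> t) k = 0) \<and>
         (\<forall>t\<in>J. \<forall>n. a n t > 0) \<and>
         (\<forall>t\<in>J. \<forall>n.
            (a n has_real_derivative
               a n t * (a (n + 1) t - (if n = 0 then 0 else a (n - 1) t))) (at t within J)) \<and>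
         (\<forall>t\<in>J. summable (\<lambda>n. ln (a n t)))"
proof -
  interpret real_distribution \<rho> by fact
  have sets: "sets \<rho> = sets borel" by simp
  have fin: "finite_measure \<rho>" by unfold_locales
  define F where "F = {\<xi>. \<xi> \<notin> {-2..2} \<and> emeasure \<rho> {\<xi>} > 0}"
  have finF: "finite F" using assms(4) by (simp add: F_def)
  have supp: "AE x in \<rho>. x \<in> {-2..2} \<union> F"
    using AE_essential_support[OF sets] unfolding assms(3) by eventually_elim (auto simp: F_def)
  define B where "B = 2 + (\<Sum>z\<in>F. \<bar>z\<bar>)"
  have B: "AE x in \<rho>. \<bar>x\<bar> \<le> B"
    using supp
  proof eventually_elim
    case (elim x)
    have "(\<Sum>z\<in>F. \<bar>z\<bar>) \<ge> 0" by (rule sum_nonneg) simp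
    moreover have "\<bar>x\<bar> \<le> 2" if "x \<notin> F" using that elim by auto
    moreover have "\<bar>x\<bar> \<le> (\<Sum>z\<in>F. \<bar>z\<bar>)" if "x \<in> F" using finF that by (intro member_le_sum) auto
    ultimately show ?case unfolding B_def by linarith
  qed
  note int = integrable_continuous_bounded_support[OF fin sets B]
  have wm [measurable]: "w \<in> borel_measurable borel" and w0: "\<And>x. 0 \<le> w x"
    using assms(5) by (auto simp: ac_part_density_def)
  have wfin: "(\<integral>\<^sup>+x. ennreal (w x) * indicator {-2..2} x \<partial>lborel) < \<infinity>"
  proof -
    have "(\<integral>\<^sup>+x. ennreal (w x) * indicator {-2..2} x \<partial>lborel) \<le> (\<integral>\<^sup>+x. indicator {-2..2} x \<partial>\<rho>)"
      by (rule ac_part_density_nn_integral_le[OF assms(5) sets]) simp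
    also have "\<dots> < \<infinity>" by (simp add: less_top[symmetric])
    finally show ?thesis .
  qed

  \<comment> \<open>The unnormalised moments, taken for all real t: the derivatives below are
    two-sided and are restricted to J only at the end.\<close>
  define s where "s t k = (\<integral>x. x ^ k * exp (x\<^sup>2 * t) \<partial>\<rho>)" for t k
  have int_s: "integrable \<rho> (\<lambda>x. x ^ k * exp (x\<^sup>2 * t))" for t k
    by (intro int continuous_intros)
  have L: "moment_functional (s t) p = (\<integral>x. poly p x * exp (x\<^sup>2 * t) \<partial>\<rho>)" for t p
    unfolding s_def by (rule moment_functional_eq_integral[OF int_s])
  have s_odd: "s t k = 0" if "odd k" for t k
    unfolding s_def by (rule even_measure_odd_integral[OF assms(2)]) (use that in auto)
  have inf: "infinite (topological_support \<rho>)"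
  proof -
    have "infinite {-2..2::real}" by simp
    moreover have "{-2..2} \<subseteq> topological_support \<rho>"
      unfolding assms(3)[symmetric] by (auto simp: essential_support_def)
    ultimately show ?thesis using finite_subset by blast
  qed
  have edm: "even_definite_moments (s t)" for t
  proof
    fix p :: "real poly" assume p: "p \<noteq> 0"
    have I: "integrable \<rho> (\<lambda>x. poly (p * p) x * exp (x\<^sup>2 * t))" by (intro int continuous_intros)
    have "(\<integral>x. poly (p * p) x * exp (x\<^sup>2 * t) \<partial>\<rho>) \<noteq> 0"
      using not_AE_poly_eq_0[OF sets inf p] by (subst integral_nonneg_eq_0_iff_AE[OF I]) auto
    moreover have "(\<integral>x. poly (p * p) x * exp (x\<^sup>2 * t) \<partial>\<rho>) \<ge> 0" by (intro integral_nonneg_AE) auto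
    ultimately show "moment_functional (s t) (p * p) > 0" unfolding L by linarith
  qed (rule s_odd)
  have s_deriv: "((\<lambda>t. s t k) has_real_derivative s t (k + 2)) (at t)" for t k
    unfolding s_def by (rule has_real_derivative_integral_exp_square[OF fin sets B])
  define h where "h n t = orthopoly_norm (s t) n" for n t
  have h: "h n t > 0" for n t
    unfolding h_def by (rule even_definite_moments.h_pos[OF edm])

  define Z where "Z t = (\<integral>x. exp (x\<^sup>2 * t) \<partial>\<rho>)" for t
  have Z: "Z t > 0" for t
    using even_definite_moments.definite[OF edm, of 1 t] unfolding L by (simp add: Z_def)
  have ev: "evolved_measure \<rho> t = density \<rho> (\<lambda>x. ennreal (exp (x\<^sup>2 * t) / Z t))" for t
    unfolding evolved_measure_def Z_def ..
  have int_exp: "integrable \<rho> (\<lambda>x. exp (x\<^sup>2 * t))" for t by (intro int continuous_intros)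
  have prob: "prob_space (evolved_measure \<rho> t)" for t
  proof (rule prob_spaceI)
    have "emeasure (evolved_measure \<rho> t) (space (evolved_measure \<rho> t)) = (\<integral>\<^sup>+x. ennreal (exp (x\<^sup>2 * t) / Z t) \<partial>\<rho>)"
      unfolding ev by (subst emeasure_density) auto
    also have "\<dots> = ennreal (\<integral>x. exp (x\<^sup>2 * t) / Z t \<partial>\<rho>)"
      using int_exp Z[of t] by (intro nn_integral_eq_integral) (auto simp: less_imp_le)
    also have "(\<integral>x. exp (x\<^sup>2 * t) / Z t \<partial>\<rho>) = 1" using Z[of t] by (simp add: Z_def)
    finally show "emeasure (evolved_measure \<rho> t) (space (evolved_measure \<rho> t)) = 1" by simp
  qed
  have int_ev: "integrable (evolved_measure \<rho> t) (\<lambda>x. x ^ k)" for t k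
    unfolding ev using Z[of t] int_s[of k t]
    by (subst integrable_density) (auto simp: less_imp_le mult.commute)
  have moment_ev: "moment (evolved_measure \<rho> t) k = 1 / Z t * s t k" for t k
  proof -
    have "moment (evolved_measure \<rho> t) k = (\<integral>x. (exp (x\<^sup>2 * t) / Z t) *\<^sub>R x ^ k \<partial>\<rho>)"
      unfolding moment_def ev by (rule integral_density) (use Z[of t] in \<open>auto simp: less_imp_le\<close>)
    also have "\<dots> = (\<integral>x. 1 / Z t * (x ^ k * exp (x\<^sup>2 * t)) \<partial>\<rho>)"
      by (intro Bochner_Integration.integral_cong refl) (simp add: mult.commute)
    finally show ?thesis by (simp add: s_def)
  qed
  have a_eq: "a n = (\<lambda>t. h (n + 1) t / h n t)" for n
  proof
    fix t
    have H: "hankel_det (s t) m = (\<Prod>k<m. h k t)" for m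
      unfolding h_def by (rule even_definite_moments.hankel_det_eq_prod[OF edm])
    define H0 where "H0 = (\<Prod>k<n. h k t)"
    have "(\<Prod>k<n. h k t) = H0" "(\<Prod>k<n+1. h k t) = H0 * h n t" "(\<Prod>k<n+2. h k t) = H0 * h n t * h (n + 1) t"
      by (simp_all add: H0_def)
    moreover have "H0 > 0" using h unfolding H0_def by (intro prod_pos) auto
    moreover have "moment (evolved_measure \<rho> t) = (\<lambda>k. 1 / Z t * s t k)" using moment_ev by auto
    ultimately show "a n t = h (n + 1) t / h n t"
      using h[of n t] Z[of t]
      unfolding a_def volterra_coeff_def Let_def
      by (simp only: hankel_det_scale H) (simp add: field_simps power2_eq_square)
  qed
  have a_pos: "a n t > 0" for n t unfolding a_eq using h by simp
  have deriv: "(a n has_real_derivative a n t * (a (n + 1) t - (if n = 0 then 0 else a (n - 1) t))) (at t)" for n t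
    unfolding a_eq h_def using volterra_orthopoly_norm[of s, OF edm s_deriv, of n t] by simp
  have summable: "summable (\<lambda>n. ln (a n t))" if t: "t \<ge> 0" for t
  proof -
    let ?\<mu> = "density \<rho> (\<lambda>x. ennreal (exp (x\<^sup>2 * t)))"
    have "\<exists>E>0. monic_norm_limit ?\<mu> E"
    \<comment> \<open>For t \<ge> 0 the factor exp (x^2 t) is at least 1, so the unnormalised
      evolved measure dominates w with constant 1.\<close>
    proof (rule monic_norm_limit_szego[where F = F and \<kappa> = 1, OF finF _ wm w0 wfin assms(6)])
      show "F \<inter> {-2..2} = {}" by (auto simp: F_def)
      show "finite_measure ?\<mu>"
        by (rule finite_measure_density_continuous[OF fin sets B]) (auto intro!: continuous_intros)
      show "AE x in ?\<mu>. x \<in> {-2..2} \<union> F" using supp by (subst AE_density) auto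
      show "emeasure ?\<mu> {y} > 0" if "y \<in> F" for y
      proof -
        have "emeasure ?\<mu> {y} = (\<integral>\<^sup>+x. ennreal (exp (x\<^sup>2 * t)) * indicator {y} x \<partial>\<rho>)"
          by (subst emeasure_density) auto
        also have "\<dots> = ennreal (exp (y\<^sup>2 * t)) * emeasure \<rho> {y}"
          by (subst nn_integral_indicator_singleton) auto
        also have "\<dots> > 0" using that by (auto simp: F_def ennreal_zero_less_mult_iff)
        finally show ?thesis .
      qed
      fix f :: "real \<Rightarrow> ennreal" assume f [measurable]: "f \<in> borel_measurable borel"
      have "(\<integral>\<^sup>+x. f x * ennreal (w x) * indicator {-2..2} x \<partial>lborel) \<le> (\<integral>\<^sup>+x. ennreal (w x) * f x \<partial>lborel)"
        by (intro nn_integral_mono) (auto simp: indicator_def mult.commute)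
      also have "\<dots> \<le> (\<integral>\<^sup>+x. f x \<partial>\<rho>)"
        by (rule ac_part_density_nn_integral_le[OF assms(5) sets f])
      also have "\<dots> \<le> (\<integral>\<^sup>+x. ennreal (exp (x\<^sup>2 * t)) * f x \<partial>\<rho>)"
      proof (rule nn_integral_mono)
        fix x
        have "ennreal 1 \<le> ennreal (exp (x\<^sup>2 * t))" using t by (intro ennreal_leI) simp
        from mult_right_mono[OF this, of "f x"] show "f x \<le> ennreal (exp (x\<^sup>2 * t)) * f x" by simp
      qed
      also have "\<dots> = (\<integral>\<^sup>+x. f x \<partial>?\<mu>)" by (subst nn_integral_density) auto
      finally show "ennreal 1 * (\<integral>\<^sup>+x. f x * ennreal (w x) * indicator {-2..2} x \<partial>lborel) \<le> (\<integral>\<^sup>+x. f x \<partial>?\<mu>)"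
        by simp
    qed auto
    then obtain E where E: "E > 0" "monic_norm_limit ?\<mu> E" by blast
    have "(\<lambda>n. h n t) \<longlonglongrightarrow> E"
      unfolding h_def
    proof (rule monic_norm_limit_orthopoly[OF edm _ E(2)])
      fix p :: "real poly"
      have "(\<integral>x. (poly p x)\<^sup>2 \<partial>?\<mu>) = (\<integral>x. exp (x\<^sup>2 * t) *\<^sub>R (poly p x)\<^sup>2 \<partial>\<rho>)"
        by (rule integral_density) (auto intro!: borel_measurable_integrable int continuous_intros)
      thus "moment_functional (s t) (p * p) = (\<integral>x. (poly p x)\<^sup>2 \<partial>?\<mu>)"
        unfolding L by (simp add: power2_eq_square mult.commute)
    qed
    hence "(\<lambda>n. ln (h n t)) \<longlonglongrightarrow> ln E" using E(1) by (intro tendsto_ln) auto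
    hence "summable (\<lambda>n. ln (h (Suc n) t) - ln (h n t))" by (rule telescope_summable)
    moreover have "ln (a n t) = ln (h (Suc n) t) - ln (h n t)" for n
      unfolding a_eq using h[of n t] h[of "Suc n" t] by (simp add: ln_div)
    ultimately show ?thesis by simp
  qed
  have odd: "moment (evolved_measure \<rho> t) k = 0" if "odd k" for t k
    using s_odd[OF that] by (simp add: moment_ev)
  have J: "t \<ge> 0" if "t \<in> J" for t using that by (simp add: J_def)
  show ?thesis
    by (intro conjI ballI allI impI int_exp prob int_ev a_pos odd summable J
        has_field_derivative_at_within[OF deriv])
qed

end
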